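(* If $F:[B(\mathcal H)^n]_1\to[B(\mathcal H)^m]_1^-$ is a free holomorphic function, then $$\|F(X)\|\le\frac{\|X\|+\|F(0)\|}{1+\|X\|\,\|F(0)\|},\qquad X\in[B(\mathcal H)^n]_1.$$ If, in addition, the boundary function of $F$ has its entries in the noncommutative disc algebra $\mathcal A_n$, then the inequality above can be extended to any $X\in[B(\mathcal H)^n]_1^-$.
   Context: $\mathcal H$ is a separable infinite dimensional Hilbert space. A tuple $X=(X_1,\dots,X_n)\in B(\mathcal H)^n$ is identified with the row operator $[X_1\,\cdots\,X_n]$; $\|X\|=\|\sum_iX_iX_i^*\|^{1/2}$, $[B(\mathcal H)^n]_1=\{X:\|X\|<1\}$, $[B(\mathcal H)^n]_1^-=\{X:\|X\|\le1\}$. $\mathbb F_n^+$ is the unital free semigroup on $g_1,\dots,g_n$; for $\alpha=g_{i_1}\cdots g_{i_k}$ put $|\alpha|=k$, $X_\alpha=X_{i_1}\cdots X_{i_k}$ ($X_\alpha=I$ for the neutral element, of length $0$). $F=(F_1,\dots,F_m)$ is free holomorphic if each $F_j:[B(\mathcal H)^n]_1\to B(\mathcal H)$ has the form $F_j(X)=\sum_{k=0}^\infty\sum_{|\alpha|=k}a_\alpha^{(j)}X_\alpha$, $a_\alpha^{(j)}\in\mathbb C$, the series in $k$ converging in operator norm for all $X\in[B(\mathcal H)^n]_1$; the same series evaluates $F$ at strict row contractions on any Hilbert space. $\|F(X)\|$ is the row norm. $S_i\varphi=e_i\otimes\varphi$ ($i=1,\dots,n$) are the left creation operators on the full Fock space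 $F^2(H_n)=\mathbb C1\oplus\bigoplus_{k\ge1}H_n^{\otimes k}$, where $H_n$ is an $n$-dimensional Hilbert space with orthonormal basis $e_1,\dots,e_n$; $\mathcal A_n$ is the norm closed algebra generated by $S_1,\dots,S_n$ and $I$. The boundary function of $F$ is $\widetilde F=(\widetilde F_1,\dots,\widetilde F_m)$, $\widetilde F_j=\text{SOT-}\lim_{r\to1}F_j(rS_1,\dots,rS_n)$. When all $\widetilde F_j\in\mathcal A_n$, $F$ extends continuously to the closed ball by $F(X)=\lim_{r\to1}F(rX_1,\dots,rX_n)$ (operator norm), $X\in[B(\mathcal H)^n]_1^-$. *)

theory Defs
  imports "HOL-Analysis.Analysis"
begin

section \<open>Complex Hilbert spaces\<close>

class complex_vector = real_vector +
  fixes scaleC :: "complex \<Rightarrow> 'a \<Rightarrow> 'a"  (infixr \<open>*\<^sub>C\<close> 75)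
  assumes scaleC_add_right: "c *\<^sub>C (x + y) = c *\<^sub>C x + c *\<^sub>C y"
    and scaleC_add_left: "(c + d) *\<^sub>C x = c *\<^sub>C x + d *\<^sub>C x"
    and scaleC_scaleC: "c *\<^sub>C d *\<^sub>C x = (c * d) *\<^sub>C x"
    and scaleC_of_real: "complex_of_real r *\<^sub>C x = r *\<^sub>R x"

lemma scaleC_one [simp]: "1 *\<^sub>C (x :: 'a :: complex_vector) = x"
  using scaleC_of_real[of 1 x] by simp

global_interpretation complex_vector: vector_space "scaleC :: complex \<Rightarrow> 'a \<Rightarrow> 'a :: complex_vector"
  by unfold_locales (simp_all add: scaleC_add_right scaleC_add_left scaleC_scaleC)

text \<open>The inner product is linear in the first argument.\<close>

class chilbert_space = complex_vector + real_normed_vector + complete_space +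
  fixes cinner :: "'a \<Rightarrow> 'a \<Rightarrow> complex"
  assumes cinner_commute: "cinner x y = cnj (cinner y x)"
    and cinner_add_left: "cinner (x + y) z = cinner x z + cinner y z"
    and cinner_scaleC_left: "cinner (c *\<^sub>C x) y = c * cinner x y"
    and cinner_self: "cinner x x = complex_of_real ((norm x)\<^sup>2)"

lemma norm_scaleC: "norm (c *\<^sub>C x) = cmod c * norm (x :: 'a :: chilbert_space)"
proof -
  have "cinner (c *\<^sub>C x) (c *\<^sub>C x) = c * cinner x (c *\<^sub>C x)"
    by (rule cinner_scaleC_left)
  also have "cinner x (c *\<^sub>C x) = cnj (cinner (c *\<^sub>C x) x)"
    by (rule cinner_commute)
  also have "cinner (c *\<^sub>C x) x = c * cinner x x"
    by (rule cinner_scaleC_left)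
  finally have "complex_of_real ((norm (c *\<^sub>C x))\<^sup>2)
      = c * cnj (c * complex_of_real ((norm x)\<^sup>2))"
    unfolding cinner_self .
  also have "\<dots> = complex_of_real ((cmod c)\<^sup>2) * complex_of_real ((norm x)\<^sup>2)"
    by (simp only: complex_cnj_mult complex_cnj_complex_of_real complex_norm_square mult.assoc)
  also have "\<dots> = complex_of_real ((cmod c * norm x)\<^sup>2)"
    by (simp only: of_real_mult power_mult_distrib)
  finally have "(norm (c *\<^sub>C x))\<^sup>2 = (cmod c * norm x)\<^sup>2"
    unfolding of_real_eq_iff .
  thus ?thesis
    by (simp add: power2_eq_iff_nonneg)
qed

definition separable_infinite_dimensional :: "'h :: chilbert_space itself \<Rightarrow> bool" where
  "separable_infinite_dimensional _ \<longleftrightarrow>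
     (\<exists>D :: 'h set. countable D \<and> closure D = UNIV) \<and>
     \<not> (\<exists>B :: 'h set. finite B \<and> complex_vector.span B = UNIV)"


section \<open>Bounded operators\<close>

text \<open>
  An operator is a bounded real-linear map that commutes with complex scalars; its norm as an
  element of the type of bounded real-linear maps is the usual operator norm.
\<close>

type_synonym 'h op = "'h \<Rightarrow>\<^sub>L 'h"

definition bounded_ops :: "'h :: chilbert_space op set" where
  "bounded_ops = {T. \<forall>c x. blinfun_apply T (c *\<^sub>C x) = c *\<^sub>C blinfun_apply T x}"

lemma bounded_linear_scaleC: "bounded_linear (\<lambda>x :: 'h :: chilbert_space. c *\<^sub>C x)"
proof (rule bounded_linear_intro[where K = "cmod c"])
  fix r :: real and x :: 'h
  show "c *\<^sub>C (r *\<^sub>R x) = r *\<^sub>R (c *\<^sub>C x)"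
    by (simp add: scaleC_scaleC mult.commute flip: scaleC_of_real)
qed (simp_all add: scaleC_add_right norm_scaleC mult.commute)

instantiation blinfun :: (real_normed_vector, chilbert_space) complex_vector
begin

lift_definition scaleC_blinfun :: "complex \<Rightarrow> 'a \<Rightarrow>\<^sub>L 'b \<Rightarrow> 'a \<Rightarrow>\<^sub>L 'b" is "\<lambda>c T x. c *\<^sub>C T x"
  by (rule bounded_linear_compose[OF bounded_linear_scaleC])

instance
  by standard (transfer; simp add: scaleC_add_right scaleC_add_left scaleC_scaleC scaleC_of_real)+

end

text \<open>For T in bounded_ops the adjoint exists and is unique, by the Riesz representation theorem.\<close>

definition adj :: "'h :: chilbert_space op \<Rightarrow> 'h op" where
  "adj T = (THE T'. \<forall>x y. cinner (blinfun_apply T x) y = cinner x (blinfun_apply T' y))"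


section \<open>Row operators and free holomorphic functions\<close>

text \<open>
  An n-tuple of operators is a function on a finite index type of cardinality n, and the words over
  that type are the elements of the free semigroup on n generators.
\<close>

definition row_norm :: "('n :: finite \<Rightarrow> 'h :: chilbert_space op) \<Rightarrow> real" where
  "row_norm X = sqrt (norm (\<Sum>i\<in>UNIV. X i o\<^sub>L adj (X i)))"

definition row_ball :: "('n :: finite \<Rightarrow> 'h :: chilbert_space op) set" where
  "row_ball = {X. (\<forall>i. X i \<in> bounded_ops) \<and> row_norm X < 1}"

definition row_cball :: "('n :: finite \<Rightarrow> 'h :: chilbert_space op) set" where
  "row_cball = {X. (\<forall>i. X i \<in> bounded_ops) \<and> row_norm X \<le> 1}"

primrec word_op :: "('n \<Rightarrow> 'h :: chilbert_space op) \<Rightarrow> 'n list \<Rightarrow> 'h op" where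
  "word_op X [] = id_blinfun"
| "word_op X (i # \<alpha>) = X i o\<^sub>L word_op X \<alpha>"

definition homogeneous_part ::
    "('n :: finite list \<Rightarrow> complex) \<Rightarrow> ('n \<Rightarrow> 'h :: chilbert_space op) \<Rightarrow> nat \<Rightarrow> 'h op" where
  "homogeneous_part a X k = (\<Sum>\<alpha> | length \<alpha> = k. a \<alpha> *\<^sub>C word_op X \<alpha>)"

definition has_free_expansion ::
    "(('n :: finite \<Rightarrow> 'h :: chilbert_space op) \<Rightarrow> 'h op) \<Rightarrow> ('n list \<Rightarrow> complex) \<Rightarrow> bool" where
  "has_free_expansion f a \<longleftrightarrow> (\<forall>X\<in>row_ball. homogeneous_part a X sums f X)"

definition free_holomorphic ::
    "(('n :: finite \<Rightarrow> 'h :: chilbert_space op) \<Rightarrow> 'm :: finite \<Rightarrow> 'h op) \<Rightarrow> bool" where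
  "free_holomorphic F \<longleftrightarrow> (\<forall>j. \<exists>a. has_free_expansion (\<lambda>X. F X j) a)"

text \<open>Evaluation of the series at tuples of operators on an arbitrary Hilbert space.\<close>

definition free_eval ::
    "('n :: finite list \<Rightarrow> complex) \<Rightarrow> ('n \<Rightarrow> 'k :: chilbert_space op) \<Rightarrow> 'k op" where
  "free_eval a X = (\<Sum>k. homogeneous_part a X k)"


section \<open>Square-summable families\<close>

lemma L2_set_le_sqrt_infsum:
  fixes f :: "'i \<Rightarrow> real"
  assumes "(\<lambda>i. (f i)\<^sup>2) summable_on UNIV" "finite A"
  shows "L2_set f A \<le> sqrt (\<Sum>\<^sub>\<infinity>i. (f i)\<^sup>2)"
  unfolding L2_set_def
  by (intro real_sqrt_le_mono finite_sum_le_infsum assms) auto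

lemma L2_set_bounded:
  fixes f :: "'i \<Rightarrow> real"
  assumes le: "\<And>A. finite A \<Longrightarrow> L2_set f A \<le> e"
  shows "(\<lambda>i. (f i)\<^sup>2) summable_on UNIV" "sqrt (\<Sum>\<^sub>\<infinity>i. (f i)\<^sup>2) \<le> e"
proof -
  have e: "e \<ge> 0"
    using le[of "{}"] by simp
  have *: "(\<Sum>i\<in>A. (f i)\<^sup>2) \<le> e\<^sup>2" if "finite A" for A
    using le[OF that] e by (metis L2_set_def real_sqrt_le_iff real_sqrt_pow2 real_sqrt_unique)
  show s: "(\<lambda>i. (f i)\<^sup>2) summable_on UNIV"
    by (rule nonneg_bdd_above_summable_on) (use * in \<open>auto intro!: bdd_aboveI\<close>)
  have "(\<Sum>\<^sub>\<infinity>i. (f i)\<^sup>2) \<le> e\<^sup>2"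
    by (rule infsum_le_finite_sums[OF s]) (use * in auto)
  thus "sqrt (\<Sum>\<^sub>\<infinity>i. (f i)\<^sup>2) \<le> e"
    using e by (simp add: real_le_lsqrt infsum_nonneg)
qed

definition square_summable :: "('i \<Rightarrow> complex) \<Rightarrow> bool" where
  "square_summable f \<longleftrightarrow> (\<lambda>i. (cmod (f i))\<^sup>2) summable_on UNIV"

definition l2norm :: "('i \<Rightarrow> complex) \<Rightarrow> real" where
  "l2norm f = sqrt (\<Sum>\<^sub>\<infinity>i. (cmod (f i))\<^sup>2)"

lemma l2norm_nonneg: "l2norm f \<ge> 0"
  by (simp add: l2norm_def infsum_nonneg)

lemma L2_set_le_l2norm: "square_summable f \<Longrightarrow> finite A \<Longrightarrow> L2_set (\<lambda>i. cmod (f i)) A \<le> l2norm f"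
  unfolding square_summable_def l2norm_def by (rule L2_set_le_sqrt_infsum)

lemma square_summableI:
  assumes "\<And>A. finite A \<Longrightarrow> L2_set (\<lambda>i. cmod (f i)) A \<le> e"
  shows "square_summable f" "l2norm f \<le> e"
  unfolding square_summable_def l2norm_def using L2_set_bounded[OF assms] by auto

lemma cmod_le_l2norm: "square_summable f \<Longrightarrow> cmod (f i) \<le> l2norm f"
  using L2_set_le_l2norm[of f "{i}"] by simp

lemma L2_set_add_le:
  assumes "square_summable f" "square_summable g" "finite A"
  shows "L2_set (\<lambda>i. cmod (f i + g i)) A \<le> l2norm f + l2norm g"
proof -
  have "L2_set (\<lambda>i. cmod (f i + g i)) A \<le> L2_set (\<lambda>i. cmod (f i) + cmod (g i)) A"
    by (intro L2_set_mono norm_triangle_ineq) auto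
  also have "\<dots> \<le> L2_set (\<lambda>i. cmod (f i)) A + L2_set (\<lambda>i. cmod (g i)) A"
    by (rule L2_set_triangle_ineq)
  also have "\<dots> \<le> l2norm f + l2norm g"
    using assms by (intro add_mono L2_set_le_l2norm)
  finally show ?thesis .
qed

lemmas square_summable_add = square_summableI(1)[OF L2_set_add_le]
lemmas l2norm_triangle = square_summableI(2)[OF L2_set_add_le]

lemma l2norm_scale: "l2norm (\<lambda>i. c * f i) = cmod c * l2norm f"
  by (simp add: l2norm_def norm_mult power_mult_distrib infsum_cmult_right' real_sqrt_mult)

lemma square_summable_scale: "square_summable f \<Longrightarrow> square_summable (\<lambda>i. c * f i)"
  unfolding square_summable_def norm_mult power_mult_distrib by (rule summable_on_cmult_right)

lemma square_summable_zero: "square_summable (\<lambda>_. 0)"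
  by (simp add: square_summable_def)

lemma square_summable_diff:
  "square_summable f \<Longrightarrow> square_summable g \<Longrightarrow> square_summable (\<lambda>i. f i - g i)"
  using square_summable_add[of f "\<lambda>i. (-1) * g i"] square_summable_scale[of g "-1"] by simp

lemma l2norm_eq_0: "square_summable f \<Longrightarrow> l2norm f = 0 \<Longrightarrow> f i = 0"
  using cmod_le_l2norm[of f i] by simp

lemma summable_on_inner:
  assumes "square_summable f" "square_summable g"
  shows "(\<lambda>i. f i * cnj (g i)) summable_on UNIV"
proof (rule abs_summable_summable)
  show "(\<lambda>i. norm (f i * cnj (g i))) summable_on UNIV"
  proof (rule summable_on_comparison_test)
    show "(\<lambda>i. (cmod (f i))\<^sup>2 + (cmod (g i))\<^sup>2) summable_on UNIV"
      using assms unfolding square_summable_def by (rule summable_on_add)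
    show "norm (f i * cnj (g i)) \<le> (cmod (f i))\<^sup>2 + (cmod (g i))\<^sup>2" for i
    proof -
      have "2 * (cmod (f i) * cmod (g i)) \<le> (cmod (f i))\<^sup>2 + (cmod (g i))\<^sup>2"
        using sum_squares_bound[of "cmod (f i)" "cmod (g i)"] by (simp add: mult.assoc)
      moreover have "0 \<le> cmod (f i) * cmod (g i)"
        by simp
      ultimately show ?thesis
        unfolding norm_mult complex_mod_cnj by linarith
    qed
  qed auto
qed

typedef 'i ell2 = "{f :: 'i \<Rightarrow> complex. square_summable f}"
  using square_summable_zero by blast

setup_lifting type_definition_ell2

instantiation ell2 :: (type) complex_vector
begin

lift_definition zero_ell2 :: "'a ell2" is "\<lambda>_. 0"
  by (rule square_summable_zero)
lift_definition plus_ell2 :: "'a ell2 \<Rightarrow> 'a ell2 \<Rightarrow> 'a ell2" is "\<lambda>f g i. f i + g i"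
  by (rule square_summable_add)
lift_definition minus_ell2 :: "'a ell2 \<Rightarrow> 'a ell2 \<Rightarrow> 'a ell2" is "\<lambda>f g i. f i - g i"
  by (rule square_summable_diff)
lift_definition uminus_ell2 :: "'a ell2 \<Rightarrow> 'a ell2" is "\<lambda>f i. - f i"
  using square_summable_scale[of _ "-1"] by simp
lift_definition scaleC_ell2 :: "complex \<Rightarrow> 'a ell2 \<Rightarrow> 'a ell2" is "\<lambda>c f i. c * f i"
  by (rule square_summable_scale)
definition scaleR_ell2 :: "real \<Rightarrow> 'a ell2 \<Rightarrow> 'a ell2" where
  "scaleR_ell2 r = scaleC (complex_of_real r)"

instance
  by standard (unfold scaleR_ell2_def, (transfer; auto simp: algebra_simps fun_eq_iff)+)

end

instantiation ell2 :: (type) real_normed_vector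
begin

lift_definition norm_ell2 :: "'a ell2 \<Rightarrow> real" is l2norm .
definition dist_ell2 :: "'a ell2 \<Rightarrow> 'a ell2 \<Rightarrow> real" where
  "dist_ell2 x y = norm (x - y)"
definition sgn_ell2 :: "'a ell2 \<Rightarrow> 'a ell2" where
  "sgn_ell2 x = x /\<^sub>R norm x"
definition uniformity_ell2 :: "('a ell2 \<times> 'a ell2) filter" where
  "uniformity_ell2 = (INF e\<in>{0<..}. principal {(x, y). dist x y < e})"
definition open_ell2 :: "'a ell2 set \<Rightarrow> bool" where
  "open_ell2 U \<longleftrightarrow> (\<forall>x\<in>U. \<forall>\<^sub>F (x', y) in uniformity. x' = x \<longrightarrow> y \<in> U)"

instance
proof
  fix x y :: "'a ell2" and r :: real
  show "norm x = 0 \<longleftrightarrow> x = 0"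
    by transfer (auto simp: fun_eq_iff l2norm_eq_0, simp add: l2norm_def)
  show "norm (x + y) \<le> norm x + norm y"
    by transfer (rule l2norm_triangle)
  show "norm (r *\<^sub>R x) = \<bar>r\<bar> * norm x"
    unfolding scaleR_ell2_def by transfer (simp add: l2norm_scale)
qed (simp_all only: dist_ell2_def sgn_ell2_def uniformity_ell2_def open_ell2_def)

end

instantiation ell2 :: (type) chilbert_space
begin

lift_definition cinner_ell2 :: "'a ell2 \<Rightarrow> 'a ell2 \<Rightarrow> complex" is
  "\<lambda>f g. \<Sum>\<^sub>\<infinity>i. f i * cnj (g i)" .

instance
proof
  fix x y z :: "'a ell2" and c :: complex
  show "cinner x y = cnj (cinner y x)"
    by transfer (simp add: mult.commute flip: infsum_cnj)
  show "cinner (x + y) z = cinner x z + cinner y z"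
    by transfer (simp add: distrib_right infsum_add summable_on_inner)
  show "cinner (c *\<^sub>C x) y = c * cinner x y"
    by transfer (simp add: mult.assoc infsum_cmult_right')
  show "cinner x x = complex_of_real ((norm x)\<^sup>2)"
  proof transfer
    fix f :: "'a \<Rightarrow> complex"
    assume f: "square_summable f"
    have "(\<Sum>\<^sub>\<infinity>i. f i * cnj (f i)) = (\<Sum>\<^sub>\<infinity>i. complex_of_real ((cmod (f i))\<^sup>2))"
      by (simp only: complex_norm_square)
    also have "\<dots> = complex_of_real (\<Sum>\<^sub>\<infinity>i. (cmod (f i))\<^sup>2)"
      using f unfolding square_summable_def
      by (intro infsumI has_sum_of_real has_sum_infsum)
    finally show "(\<Sum>\<^sub>\<infinity>i. f i * cnj (f i)) = complex_of_real ((l2norm f)\<^sup>2)"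
      by (simp add: l2norm_def infsum_nonneg)
  qed
next
  fix X :: "nat \<Rightarrow> 'a ell2"
  assume X: "Cauchy X"
  define f where "f n = Rep_ell2 (X n)" for n
  have f: "square_summable (f n)" for n
    using Rep_ell2[of "X n"] by (simp add: f_def)
  have norm_diff: "norm (X m - X n) = l2norm (\<lambda>i. f m i - f n i)" for m n
    by (simp add: norm_ell2.rep_eq minus_ell2.rep_eq f_def)
  have "Cauchy (\<lambda>n. f n i)" for i
  proof (rule metric_CauchyI)
    fix e :: real assume "e > 0"
    then obtain M where M: "\<And>m n. m \<ge> M \<Longrightarrow> n \<ge> M \<Longrightarrow> dist (X m) (X n) < e"
      using metric_CauchyD[OF X] by blast
    have "dist (f m i) (f n i) \<le> dist (X m) (X n)" for m n
      using cmod_le_l2norm[OF square_summable_diff[OF f[of m] f[of n]], of i]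
      by (simp add: dist_norm norm_diff)
    thus "\<exists>M. \<forall>m\<ge>M. \<forall>n\<ge>M. dist (f m i) (f n i) < e"
      using M by (meson le_less_trans)
  qed
  hence "\<exists>l. (\<lambda>n. f n i) \<longlonglongrightarrow> l" for i
    using Cauchy_convergent convergent_def by blast
  then obtain l where l: "\<And>i. (\<lambda>n. f n i) \<longlonglongrightarrow> l i"
    by metis
  have close: "\<exists>M. \<forall>m\<ge>M. square_summable (\<lambda>i. f m i - l i) \<and> l2norm (\<lambda>i. f m i - l i) \<le> e"
    if "e > 0" for e :: real
  proof -
    obtain M where M: "\<And>m n. m \<ge> M \<Longrightarrow> n \<ge> M \<Longrightarrow> dist (X m) (X n) < e"
      using metric_CauchyD[OF X \<open>e > 0\<close>] by blast
    have "L2_set (\<lambda>i. cmod (f m i - l i)) A \<le> e" if m: "m \<ge> M" and A: "finite A" for m A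
    proof (rule LIMSEQ_le_const2)
      show "(\<lambda>n. L2_set (\<lambda>i. cmod (f m i - f n i)) A) \<longlonglongrightarrow> L2_set (\<lambda>i. cmod (f m i - l i)) A"
        unfolding L2_set_def by (intro tendsto_intros l)
      have "L2_set (\<lambda>i. cmod (f m i - f n i)) A \<le> e" if "n \<ge> M" for n
      proof -
        have "L2_set (\<lambda>i. cmod (f m i - f n i)) A \<le> l2norm (\<lambda>i. f m i - f n i)"
          by (intro L2_set_le_l2norm square_summable_diff f A)
        thus ?thesis
          using M[OF m that] by (simp add: dist_norm norm_diff)
      qed
      thus "\<exists>N. \<forall>n\<ge>N. L2_set (\<lambda>i. cmod (f m i - f n i)) A \<le> e"
        by blast
    qed
    hence "square_summable (\<lambda>i. f m i - l i) \<and> l2norm (\<lambda>i. f m i - l i) \<le> e" if "m \<ge> M" for m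
      using square_summableI[of "\<lambda>i. f m i - l i" e] that by blast
    thus ?thesis
      by blast
  qed
  obtain M where "square_summable (\<lambda>i. f M i - l i)"
    using close[of 1] by auto
  from square_summable_diff[OF f[of M] this] have L: "square_summable l"
    by simp
  have "X \<longlonglongrightarrow> Abs_ell2 l"
  proof (rule metric_LIMSEQ_I)
    fix e :: real assume "e > 0"
    then obtain M where M: "\<And>m. m \<ge> M \<Longrightarrow> l2norm (\<lambda>i. f m i - l i) \<le> e / 2"
      using close[of "e / 2"] by auto
    have "dist (X m) (Abs_ell2 l) = l2norm (\<lambda>i. f m i - l i)" for m
      using L by (simp add: dist_norm norm_ell2.rep_eq minus_ell2.rep_eq f_def Abs_ell2_inverse)
    hence "dist (X m) (Abs_ell2 l) < e" if "m \<ge> M" for m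
      using M[OF that] \<open>e > 0\<close> by simp
    thus "\<exists>M. \<forall>m\<ge>M. dist (X m) (Abs_ell2 l) < e"
      by blast
  qed
  thus "convergent X"
    by (auto simp: convergent_def)
qed

end


section \<open>The full Fock space\<close>

text \<open>
  The words of length k index an orthonormal basis of the k-th tensor power of an n-dimensional
  Hilbert space, so the full Fock space is the space of square-summable families on all words. The
  left creation operator of the letter i maps the basis vector of a word w to that of i # w.
\<close>

type_synonym 'n fock = "'n list ell2"

definition create :: "'n \<Rightarrow> ('n list \<Rightarrow> complex) \<Rightarrow> 'n list \<Rightarrow> complex" where
  "create i f w = (case w of [] \<Rightarrow> 0 | j # v \<Rightarrow> if j = i then f v else 0)"

lemma create_sum:
  shows "square_summable (create i f) \<longleftrightarrow> square_summable f"
    and "l2norm (create i f) = l2norm f"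
proof -
  let ?g = "\<lambda>w. (cmod (create i f w))\<^sup>2"
  have inj: "inj (Cons i)"
    by (simp add: inj_def)
  have comp: "?g \<circ> Cons i = (\<lambda>v. (cmod (f v))\<^sup>2)"
    by (auto simp: create_def fun_eq_iff)
  have out: "?g w = 0" if "w \<in> UNIV - range (Cons i)" for w
    using that by (auto simp: create_def split: list.splits)
  have "?g summable_on UNIV \<longleftrightarrow> ?g summable_on range (Cons i)"
    by (rule summable_on_cong_neutral) (use out in auto)
  thus "square_summable (create i f) \<longleftrightarrow> square_summable f"
    unfolding square_summable_def summable_on_reindex[OF inj] comp .
  have "infsum ?g UNIV = infsum ?g (range (Cons i))"
    by (rule infsum_cong_neutral) (use out in auto)
  thus "l2norm (create i f) = l2norm f"
    unfolding l2norm_def infsum_reindex[OF inj] comp by simp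
qed

lift_definition create_ell2 :: "'n \<Rightarrow> 'n fock \<Rightarrow> 'n fock" is create
  by (simp add: create_sum)

lift_definition creation_op :: "'n \<Rightarrow> 'n fock op" is create_ell2
proof (rule bounded_linear_intro[where K = 1])
  fix i :: 'n and x y :: "'n fock" and r :: real
  show "create_ell2 i (x + y) = create_ell2 i x + create_ell2 i y"
    by transfer (auto simp: create_def fun_eq_iff split: list.splits)
  show "create_ell2 i (r *\<^sub>R x) = r *\<^sub>R create_ell2 i x"
    unfolding scaleR_ell2_def by transfer (auto simp: create_def fun_eq_iff split: list.splits)
  show "norm (create_ell2 i x) \<le> norm x * 1"
    by transfer (simp add: create_sum)
qed

definition is_op_algebra :: "'h :: chilbert_space op set \<Rightarrow> bool" where
  "is_op_algebra A \<longleftrightarrow> complex_vector.subspace A \<and> (\<forall>T\<in>A. \<forall>U\<in>A. T o\<^sub>L U \<in> A)"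

definition nc_disc_algebra :: "'n :: finite fock op set" where
  "nc_disc_algebra =
     \<Inter> {A. is_op_algebra A \<and> closed A \<and> id_blinfun \<in> A \<and> range creation_op \<subseteq> A}"

text \<open>
  On an infinite dimensional space the coefficients a are uniquely determined by f. The limit is
  taken in the strong operator topology, that is, pointwise.
\<close>

definition is_boundary_function ::
    "(('n :: finite \<Rightarrow> 'h :: chilbert_space op) \<Rightarrow> 'h op) \<Rightarrow> 'n fock op \<Rightarrow> bool" where
  "is_boundary_function f T \<longleftrightarrow>
     (\<exists>a. has_free_expansion f a \<and>
       (\<forall>\<xi>. ((\<lambda>r. blinfun_apply (free_eval a (\<lambda>i. r *\<^sub>R creation_op i)) \<xi>)
               \<longlongrightarrow> blinfun_apply T \<xi>) (at_left 1)))"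

text \<open>Y is the value at X of the extension of F by radial limits in the operator norm.\<close>

definition is_radial_limit ::
    "(('n :: finite \<Rightarrow> 'h :: chilbert_space op) \<Rightarrow> 'm :: finite \<Rightarrow> 'h op) \<Rightarrow>
     ('n \<Rightarrow> 'h op) \<Rightarrow> ('m \<Rightarrow> 'h op) \<Rightarrow> bool" where
  "is_radial_limit F X Y \<longleftrightarrow> (\<forall>j. ((\<lambda>r. F (\<lambda>i. r *\<^sub>R X i) j) \<longlongrightarrow> Y j) (at_left 1))"

end

theory Submission
  imports Defs "HOL-Complex_Analysis.Conformal_Mappings"
begin

text \<open>
  Both inequalities are the Schwarz--Pick inequality for scalar functions on the unit disc. For X \<noteq> 0
  in the open row ball and X' = X / |X|, every matrix coefficient
  h(z) = \<Sum>_j <F_j(z X') \<xi>_j, \<eta>> of the row operator F(z X') is holomorphic on the disc and bounded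
  by |\<xi>| |\<eta>|, and |h(0)| is at most |F(0)| times that bound. The Schwarz--Pick inequality at z = |X|
  bounds |h(|X|)|, and the supremum over unit vectors \<xi>, \<eta> is |F(X)| (row_norm_Schwarz_Pick). This
  uses that row_norm is the norm of the row as an operator, which rests on the Riesz theorem and the
  existence of adjoints (cmod_row_form_le, row_norm_leI).

  On the closed ball only the existence of the radial limits is left, because the bound passes to
  limits and is monotone in |X| (row_norm_tendsto_le, Schwarz_Pick_fraction_mono). Let f be an entry of F,
  with coefficients a, and T its boundary function.

  \<^item> The Fourier coefficients of T at the vacuum are the a_\<alpha> (boundary_function_coefficient). This needs
    the series at r S to converge in norm. Evaluating f at truncated creation operators, built on
    an orthonormal family of the infinite dimensional space, and applying the Cauchy estimates gives
    \<Sum> |a_\<alpha>|^2 \<le> 1 over the words of each length (sum_coefficients_le).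

  \<^item> T is a norm limit of polynomials p_n(S) (nc_disc_algebra_subset_closure).

  \<^item> The von Neumann inequality |p(X)| \<le> |p(S)| (von_Neumann_row_ball) makes p_n(r X) converge
    uniformly in r < 1. Its limit is f(r X) because the coefficients converge, and each p_n(r X) is
    continuous up to r = 1, so that f(r X) has a limit there (radial_limit_exists).

  The von Neumann inequality is proved with the Poisson kernel x \<mapsto> (X_\<beta>^* x)_\<beta>, which is isometric for
  the defect form <x, x> - \<Sum> <X_i^* x, X_i^* x> and intertwines p(X)^* with p(S)^*. No square root of the
  defect operator is taken: only finitely many vectors occur in a truncation, and Gram--Schmidt
  for the semi-definite defect form turns them into finitely many scalar sequences.
\<close>

section \<open>Hilbert space preliminaries\<close>

lemma cinner_zero_left [simp]: "cinner 0 y = 0"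
  using cinner_add_left[of 0 0 y] by simp

lemma cinner_zero_right [simp]: "cinner x 0 = 0"
  using cinner_commute[of x 0] by simp

lemma cinner_add_right: "cinner x (y + z) = cinner x y + cinner x z"
  by (metis cinner_add_left cinner_commute complex_cnj_add)

lemma cinner_scaleC_right: "cinner x (c *\<^sub>C y) = cnj c * cinner x y"
  by (metis cinner_commute cinner_scaleC_left complex_cnj_mult)

lemma cinner_minus_left: "cinner (- x) y = - cinner x y"
  using cinner_add_left[of x "- x" y] by (simp add: add_eq_0_iff)

lemma cinner_minus_right: "cinner x (- y) = - cinner x y"
  using cinner_add_right[of x y "- y"] by (simp add: add_eq_0_iff)

lemma cinner_diff_left: "cinner (x - y) z = cinner x z - cinner y z"
  using cinner_add_left[of x "- y" z] by (simp add: cinner_minus_left)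

lemma cinner_diff_right: "cinner x (y - z) = cinner x y - cinner x z"
  using cinner_add_right[of x y "- z"] by (simp add: cinner_minus_right)

lemma cinner_sum_left: "cinner (\<Sum>i\<in>I. f i) y = (\<Sum>i\<in>I. cinner (f i) y)"
  by (induction I rule: infinite_finite_induct) (auto simp: cinner_add_left)

lemma cinner_sum_right: "cinner x (\<Sum>i\<in>I. f i) = (\<Sum>i\<in>I. cinner x (f i))"
  by (induction I rule: infinite_finite_induct) (auto simp: cinner_add_right)

lemma cinner_scaleR_left: "cinner (r *\<^sub>R x) y = of_real r * cinner x y"
  by (metis cinner_scaleC_left scaleC_of_real)

lemma cinner_scaleR_right: "cinner x (r *\<^sub>R y) = of_real r * cinner x y"
  by (metis cinner_scaleC_right complex_cnj_complex_of_real scaleC_of_real)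

lemma norm_sq_cinner: "(norm x)\<^sup>2 = Re (cinner x x)"
  by (simp add: cinner_self)

lemma norm_add_sq: "(norm (x + y))\<^sup>2 = (norm x)\<^sup>2 + 2 * Re (cinner x y) + (norm y)\<^sup>2"
proof -
  have "Re (cinner y x) = Re (cinner x y)"
    by (metis cinner_commute complex_cnj cnj.simps(1))
  thus ?thesis
    by (simp add: norm_sq_cinner cinner_add_left cinner_add_right)
qed

lemma norm_diff_sq: "(norm (x - y))\<^sup>2 = (norm x)\<^sup>2 - 2 * Re (cinner x y) + (norm y)\<^sup>2"
  using norm_add_sq[of x "- y"] by (simp add: cinner_minus_right)

lemma Re_cinner_le: "Re (cinner x y) \<le> norm x * norm y"
proof (cases "x = 0 \<or> y = 0")
  case False
  let ?u = "norm y *\<^sub>R x" and ?v = "norm x *\<^sub>R y"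
  have "0 \<le> (norm (?u - ?v))\<^sup>2"
    by simp
  also have "\<dots> = 2 * (norm x * norm y) * (norm x * norm y - Re (cinner x y))"
    unfolding norm_diff_sq
    by (simp add: cinner_scaleR_left cinner_scaleR_right algebra_simps power2_eq_square)
  finally have "0 \<le> (norm x * norm y) * (norm x * norm y - Re (cinner x y))"
    by simp
  moreover have "0 < norm x * norm y"
    using False by simp
  ultimately show ?thesis
    by (simp add: zero_le_mult_iff)
qed auto

lemma cmod_cinner_le: "cmod (cinner x y) \<le> norm x * norm y"
proof (cases "cinner x y = 0")
  case False
  define u where "u = cnj (sgn (cinner x y))"
  have u: "cmod u = 1"
    using False by (simp add: u_def norm_sgn)
  have "u * cinner x y = of_real (cmod (cinner x y))"
    using False unfolding u_def sgn_eq
    by (simp add: field_simps complex_norm_square[symmetric] power2_eq_square flip: of_real_mult)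
  hence "cmod (cinner x y) = Re (cinner (u *\<^sub>C x) y)"
    by (simp add: cinner_scaleC_left)
  also have "\<dots> \<le> norm (u *\<^sub>C x) * norm y"
    by (rule Re_cinner_le)
  finally show ?thesis
    by (simp add: norm_scaleC u)
qed auto

lemma norm_le_if_cinner_le:
  assumes "0 \<le> B" and "cmod (cinner v v) \<le> B * norm v"
  shows "norm v \<le> B"
proof -
  have "norm v * norm v \<le> norm v * B"
    using assms(2) by (simp add: cinner_self norm_mult power2_eq_square mult.commute)
  thus ?thesis
    using assms(1) by (cases "norm v = 0") (auto simp: mult_le_cancel_left)
qed

lemma bounded_linear_cinner_left: "bounded_linear (\<lambda>x. cinner x y)"
  by (rule bounded_linear_intro[where K = "norm y"])
    (simp_all add: cinner_add_left cinner_scaleR_left scaleR_conv_of_real cmod_cinner_le)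

lemma cinner_ext:
  assumes "\<And>x. cinner x y = cinner x z"
  shows "y = z"
proof -
  have "cinner (y - z) (y - z) = 0"
    by (subst cinner_diff_right) (simp add: assms)
  thus ?thesis
    by (simp add: cinner_self)
qed

text \<open>
  The Riesz vector is the minimiser of x \<mapsto> |x|^2 - 2 Re f(x). By the parallelogram law any
  minimising sequence is a Cauchy sequence, and the derivative of the functional at its limit vanishes.
\<close>

lemma Riesz_representation:
  fixes f :: "'h :: chilbert_space \<Rightarrow> complex"
  assumes bl: "bounded_linear f" and scale: "\<And>c x. f (c *\<^sub>C x) = c * f x"
  shows "\<exists>y. \<forall>x. f x = cinner x y"
proof -
  interpret f: bounded_linear f
    by (rule bl)
  obtain K where K: "\<And>x. cmod (f x) \<le> norm x * K"
    using f.nonneg_bounded by blast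
  define J where "J x = (norm x)\<^sup>2 - 2 * Re (f x)" for x
  have J_lower: "- (K\<^sup>2) \<le> J x" for x
  proof -
    have "Re (f x) \<le> norm x * K"
      using K[of x] complex_Re_le_cmod[of "f x"] by linarith
    moreover have "0 \<le> (norm x - K)\<^sup>2"
      by simp
    ultimately show ?thesis
      by (simp add: J_def power2_diff)
  qed
  define m where "m = Inf (range J)"
  have bdd: "bdd_below (range J)"
    using J_lower by (auto intro!: bdd_belowI)
  have m_le: "m \<le> J x" for x
    unfolding m_def by (rule cInf_lower[OF _ bdd]) auto
  have "\<exists>x. J x < m + inverse (real (Suc n))" for n
    using cInf_lessD[of "range J" "m + inverse (real (Suc n))"] unfolding m_def by auto
  then obtain X where X: "\<And>n. J (X n) < m + inverse (real (Suc n))"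
    by metis
  \<comment> \<open>the parallelogram law; J is at least m at the midpoint, so near-minimisers are close\<close>
  have J_mid: "(norm (x - y))\<^sup>2 = 2 * J x + 2 * J y - 4 * J ((1 / 2) *\<^sub>R (x + y))" for x y
  proof -
    have "(norm ((1 / 2) *\<^sub>R (x + y)))\<^sup>2 = (norm (x + y))\<^sup>2 / 4"
      by (simp add: power_mult_distrib power2_eq_square)
    moreover have "Re (f ((1 / 2) *\<^sub>R (x + y))) = (Re (f x) + Re (f y)) / 2"
      by (simp only: f.scaleR f.add) simp
    ultimately show ?thesis
      by (simp add: J_def norm_add_sq norm_diff_sq algebra_simps)
  qed
  have "Cauchy X"
  proof (rule metric_CauchyI)
    fix e :: real assume "e > 0"
    then obtain N where N: "inverse (real (Suc N)) < e\<^sup>2 / 4"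
      using reals_Archimedean[of "e\<^sup>2 / 4"] by auto
    have "dist (X k) (X l) < e" if "k \<ge> N" "l \<ge> N" for k l
    proof -
      have "inverse (real (Suc k)) \<le> inverse (real (Suc N))"
        "inverse (real (Suc l)) \<le> inverse (real (Suc N))"
        using that by (auto intro!: le_imp_inverse_le)
      hence "(norm (X k - X l))\<^sup>2 < e\<^sup>2"
        using N X[of k] X[of l] m_le[of "(1 / 2) *\<^sub>R (X k + X l)"]
        unfolding J_mid by linarith
      thus ?thesis
        using \<open>e > 0\<close> by (simp add: dist_norm power2_less_imp_less)
    qed
    thus "\<exists>M. \<forall>m\<ge>M. \<forall>n\<ge>M. dist (X m) (X n) < e"
      by blast
  qed
  then obtain y where y: "X \<longlonglongrightarrow> y"
    using Cauchy_convergent convergent_def by blast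
  have "(\<lambda>n. J (X n)) \<longlonglongrightarrow> J y"
    unfolding J_def by (intro tendsto_intros y f.tendsto)
  moreover have "(\<lambda>n. m + inverse (real (Suc n))) \<longlonglongrightarrow> m + 0"
    by (intro tendsto_intros LIMSEQ_inverse_real_of_nat)
  ultimately have "J y \<le> m + 0"
    by (rule LIMSEQ_le) (use X in \<open>auto intro: less_imp_le\<close>)
  hence J_min: "J y \<le> J x" for x
    using m_le[of x] by simp
  have Re_eq: "Re (f x) = Re (cinner x y)" for x
  proof -
    define d where "d = Re (cinner x y) - Re (f x)"
    have quad: "0 \<le> t\<^sup>2 * (norm x)\<^sup>2 + 2 * t * d" for t
    proof -
      have "J (t *\<^sub>R x + y) = J y + (t\<^sup>2 * (norm x)\<^sup>2 + 2 * t * d)"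
        unfolding J_def norm_add_sq f.add f.scaleR cinner_scaleR_left d_def
        by (simp add: algebra_simps power_mult_distrib)
      thus ?thesis
        using J_min[of "t *\<^sub>R x + y"] by simp
    qed
    have "d = 0"
    proof (rule ccontr)
      assume "d \<noteq> 0"
      show False
      proof (cases "x = 0")
        case True
        with \<open>d \<noteq> 0\<close> show False
          by (simp add: d_def f.zero)
      next
        case False
        have "0 \<le> (- d / (norm x)\<^sup>2)\<^sup>2 * (norm x)\<^sup>2 + 2 * (- d / (norm x)\<^sup>2) * d"
          by (rule quad)
        also have "\<dots> = - (d\<^sup>2 / (norm x)\<^sup>2)"
          using False by (simp add: field_simps power2_eq_square)
        finally have "d\<^sup>2 / (norm x)\<^sup>2 \<le> 0"
          by simp
        thus False
          using False \<open>d \<noteq> 0\<close> by (simp add: divide_le_0_iff)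
      qed
    qed
    thus ?thesis
      by (simp add: d_def)
  qed
  have "f x = cinner x y" for x
  proof (rule complex_eqI)
    show "Im (f x) = Im (cinner x y)"
      using Re_eq[of "\<i> *\<^sub>C x"] by (simp add: scale cinner_scaleC_left)
  qed (rule Re_eq)
  thus ?thesis
    by blast
qed

section \<open>Adjoints\<close>

lemma bounded_ops_scaleC:
  "T \<in> bounded_ops \<Longrightarrow> blinfun_apply T (c *\<^sub>C x) = c *\<^sub>C blinfun_apply T x"
  by (simp add: bounded_ops_def)

lemma bounded_opsI:
  "(\<And>c x. blinfun_apply T (c *\<^sub>C x) = c *\<^sub>C blinfun_apply T x) \<Longrightarrow> T \<in> bounded_ops"
  by (simp add: bounded_ops_def)

lemma cinner_adj:
  fixes T :: "'h :: chilbert_space op"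
  assumes T: "T \<in> bounded_ops"
  shows "cinner (blinfun_apply T x) y = cinner x (blinfun_apply (adj T) y)"
proof -
  have "\<exists>v. \<forall>x. cinner (blinfun_apply T x) y = cinner x v" for y
  proof (rule Riesz_representation)
    show "bounded_linear (\<lambda>x. cinner (blinfun_apply T x) y)"
      by (rule bounded_linear_compose[OF bounded_linear_cinner_left blinfun.bounded_linear_right])
  qed (simp add: bounded_ops_scaleC[OF T] cinner_scaleC_left)
  then obtain A where A: "\<And>x y. cinner (blinfun_apply T x) y = cinner x (A y)"
    by metis
  have "bounded_linear A"
  proof (rule bounded_linear_intro[where K = "norm T"])
    show "A (x + y) = A x + A y" for x y
      by (rule cinner_ext) (simp add: cinner_add_right flip: A)
    show "A (r *\<^sub>R x) = r *\<^sub>R A x" for r x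
      by (rule cinner_ext) (simp add: cinner_scaleR_right flip: A)
    show "norm (A x) \<le> norm x * norm T" for x
    proof -
      have "(norm (A x))\<^sup>2 = Re (cinner (blinfun_apply T (A x)) x)"
        by (simp add: A norm_sq_cinner)
      also have "\<dots> \<le> norm (blinfun_apply T (A x)) * norm x"
        by (rule Re_cinner_le)
      also have "\<dots> \<le> (norm T * norm (A x)) * norm x"
        by (intro mult_right_mono norm_blinfun) auto
      finally have "norm (A x) * norm (A x) \<le> norm (A x) * (norm x * norm T)"
        by (simp add: power2_eq_square mult_ac)
      thus ?thesis
        by (cases "norm (A x) = 0") (auto simp: mult_le_cancel_left)
    qed
  qed
  hence A': "\<forall>x y. cinner (blinfun_apply T x) y = cinner x (blinfun_apply (Blinfun A) y)"
    by (simp add: A bounded_linear_Blinfun_apply)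
  have "adj T = Blinfun A"
    unfolding adj_def
  proof (rule the_equality, rule A')
    fix B assume "\<forall>x y. cinner (blinfun_apply T x) y = cinner x (blinfun_apply B y)"
    thus "B = Blinfun A"
      using A' by (intro blinfun_eqI cinner_ext) metis
  qed
  with A' show ?thesis
    by simp
qed

lemma adj_scaleC:
  assumes "T \<in> bounded_ops"
  shows "blinfun_apply (adj T) (c *\<^sub>C x) = c *\<^sub>C blinfun_apply (adj T) x"
  by (rule cinner_ext) (simp add: cinner_scaleC_right flip: cinner_adj[OF assms])

section \<open>The row norm is the operator norm of the row\<close>

lemma norm_sum_cinner_le:
  "cmod (\<Sum>i\<in>I. cinner (x i) (y i)) \<le> L2_set (\<lambda>i. norm (x i)) I * L2_set (\<lambda>i. norm (y i)) I"
proof -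
  have "cmod (\<Sum>i\<in>I. cinner (x i) (y i)) \<le> (\<Sum>i\<in>I. \<bar>norm (x i)\<bar> * \<bar>norm (y i)\<bar>)"
    by (intro sum_norm_le) (simp add: cmod_cinner_le)
  also have "\<dots> \<le> L2_set (\<lambda>i. norm (x i)) I * L2_set (\<lambda>i. norm (y i)) I"
    by (rule L2_set_mult_ineq)
  finally show ?thesis .
qed

lemma L2_set_power2: "(L2_set f I)\<^sup>2 = (\<Sum>i\<in>I. (f i)\<^sup>2)"
  by (simp add: L2_set_def sum_nonneg)

lemma row_norm_nonneg: "0 \<le> row_norm X"
  by (simp add: row_norm_def)

lemma L2_set_adj_le:
  fixes X :: "'n :: finite \<Rightarrow> 'h :: chilbert_space op"
  assumes X: "\<And>i. X i \<in> bounded_ops"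
  shows "L2_set (\<lambda>i. norm (blinfun_apply (adj (X i)) y)) UNIV \<le> row_norm X * norm y"
proof (rule power2_le_imp_le)
  have "(L2_set (\<lambda>i. norm (blinfun_apply (adj (X i)) y)) UNIV)\<^sup>2
      = Re (cinner (blinfun_apply (\<Sum>i\<in>UNIV. X i o\<^sub>L adj (X i)) y) y)"
    by (simp add: L2_set_power2 norm_sq_cinner blinfun.sum_left cinner_sum_left cinner_adj[OF X])
  also have "\<dots> \<le> norm (blinfun_apply (\<Sum>i\<in>UNIV. X i o\<^sub>L adj (X i)) y) * norm y"
    by (rule Re_cinner_le)
  also have "\<dots> \<le> norm (\<Sum>i\<in>UNIV. X i o\<^sub>L adj (X i)) * norm y * norm y"
    by (intro mult_right_mono norm_blinfun) auto
  also have "\<dots> = (row_norm X * norm y)\<^sup>2"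
    by (simp add: row_norm_def power_mult_distrib power2_eq_square)
  finally show "(L2_set (\<lambda>i. norm (blinfun_apply (adj (X i)) y)) UNIV)\<^sup>2 \<le> (row_norm X * norm y)\<^sup>2" .
qed (simp add: row_norm_nonneg)

lemma cmod_row_form_le:
  fixes X :: "'n :: finite \<Rightarrow> 'h :: chilbert_space op"
  assumes X: "\<And>i. X i \<in> bounded_ops"
  shows "cmod (\<Sum>i\<in>UNIV. cinner (blinfun_apply (X i) (\<xi> i)) \<eta>)
    \<le> row_norm X * L2_set (\<lambda>i. norm (\<xi> i)) UNIV * norm \<eta>"
proof -
  have "cmod (\<Sum>i\<in>UNIV. cinner (blinfun_apply (X i) (\<xi> i)) \<eta>)
      \<le> L2_set (\<lambda>i. norm (\<xi> i)) UNIV * L2_set (\<lambda>i. norm (blinfun_apply (adj (X i)) \<eta>)) UNIV"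
    unfolding cinner_adj[OF X] by (rule norm_sum_cinner_le)
  also have "\<dots> \<le> L2_set (\<lambda>i. norm (\<xi> i)) UNIV * (row_norm X * norm \<eta>)"
    by (intro mult_left_mono L2_set_adj_le X L2_set_nonneg)
  finally show ?thesis
    by (simp add: mult_ac)
qed

text \<open>
  Testing the form on the tuple of the vectors X_i^* y bounds the column of the adjoints, and
  applying that bound to y and to z = (sum of X_i X_i^*) y bounds |z|^2.
\<close>

lemma row_norm_leI:
  fixes X :: "'n :: finite \<Rightarrow> 'h :: chilbert_space op"
  assumes X: "\<And>i. X i \<in> bounded_ops" and B: "0 \<le> B"
    and le: "\<And>\<xi> \<eta>. cmod (\<Sum>i\<in>UNIV. cinner (blinfun_apply (X i) (\<xi> i)) \<eta>)
      \<le> B * L2_set (\<lambda>i. norm (\<xi> i)) UNIV * norm \<eta>"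
  shows "row_norm X \<le> B"
proof -
  define A where "A y = L2_set (\<lambda>i. norm (blinfun_apply (adj (X i)) y)) UNIV" for y
  have A0: "0 \<le> A y" for y
    by (simp add: A_def)
  have A_le: "A y \<le> B * norm y" for y
  proof -
    have "(\<Sum>i\<in>UNIV. cinner (blinfun_apply (X i) (blinfun_apply (adj (X i)) y)) y)
        = of_real ((A y)\<^sup>2)"
      unfolding A_def L2_set_power2 cinner_adj[OF X] cinner_self of_real_sum ..
    with le[of "\<lambda>i. blinfun_apply (adj (X i)) y" y] have "(A y)\<^sup>2 \<le> B * A y * norm y"
      by (simp add: A_def norm_power)
    hence "A y * A y \<le> A y * (B * norm y)"
      by (simp add: power2_eq_square mult_ac)
    thus ?thesis
      using A0[of y] B by (cases "A y = 0") (auto simp: mult_le_cancel_left)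
  qed
  have "norm (\<Sum>i\<in>UNIV. X i o\<^sub>L adj (X i)) \<le> B\<^sup>2"
  proof (rule norm_blinfun_bound)
    fix y
    define z where "z = blinfun_apply (\<Sum>i\<in>UNIV. X i o\<^sub>L adj (X i)) y"
    have "cinner z z = (\<Sum>i\<in>UNIV. cinner (blinfun_apply (adj (X i)) y) (blinfun_apply (adj (X i)) z))"
      by (subst z_def) (simp add: blinfun.sum_left cinner_sum_left cinner_adj[OF X])
    also have "cmod \<dots> \<le> A y * A z"
      unfolding A_def by (rule norm_sum_cinner_le)
    also have "\<dots> \<le> (B * norm y) * (B * norm z)"
      by (intro mult_mono A_le A0) (use B in auto)
    finally show "norm z \<le> B\<^sup>2 * norm y"
      by (intro norm_le_if_cinner_le) (use B in \<open>auto simp: power2_eq_square mult_ac\<close>)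
  qed simp
  thus ?thesis
    unfolding row_norm_def using B by (simp add: real_le_lsqrt)
qed

lemma norm_row_apply_le:
  fixes X :: "'n :: finite \<Rightarrow> 'h :: chilbert_space op"
  assumes "\<And>i. X i \<in> bounded_ops"
  shows "norm (\<Sum>i\<in>UNIV. blinfun_apply (X i) (\<xi> i)) \<le> row_norm X * L2_set (\<lambda>i. norm (\<xi> i)) UNIV"
proof -
  define z where "z = (\<Sum>i\<in>UNIV. blinfun_apply (X i) (\<xi> i))"
  have "cmod (cinner z z) \<le> row_norm X * L2_set (\<lambda>i. norm (\<xi> i)) UNIV * norm z"
    using cmod_row_form_le[of X \<xi> z] assms by (simp add: z_def cinner_sum_left)
  thus ?thesis
    unfolding z_def[symmetric] by (rule norm_le_if_cinner_le[rotated]) (simp add: row_norm_nonneg)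
qed

lemma norm_entry_le_row_norm:
  fixes X :: "'n :: finite \<Rightarrow> 'h :: chilbert_space op"
  assumes "\<And>i. X i \<in> bounded_ops"
  shows "norm (X i) \<le> row_norm X"
proof (rule norm_blinfun_bound)
  fix x
  have "(\<Sum>j\<in>UNIV. blinfun_apply (X j) (if j = i then x else 0)) = blinfun_apply (X i) x"
    by (subst sum.remove[of _ i]) (auto intro!: sum.neutral)
  moreover have "L2_set (\<lambda>j. norm (if j = i then x else 0)) UNIV = norm x"
  proof -
    have "(\<Sum>j\<in>UNIV. (norm (if j = i then x else 0))\<^sup>2) = (\<Sum>j\<in>UNIV. if j = i then (norm x)\<^sup>2 else 0)"
      by (intro sum.cong) auto
    thus ?thesis
      by (simp add: L2_set_def)
  qed
  ultimately show "norm (blinfun_apply (X i) x) \<le> row_norm X * norm x"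
    using norm_row_apply_le[of X "\<lambda>j. if j = i then x else 0"] assms by simp
qed (rule row_norm_nonneg)

lemma bounded_ops_scale: "T \<in> bounded_ops \<Longrightarrow> c *\<^sub>C T \<in> bounded_ops"
  by (auto simp: bounded_ops_def scaleC_blinfun.rep_eq scaleC_scaleC mult.commute)

lemma row_norm_scaleC_le:
  fixes X :: "'n :: finite \<Rightarrow> 'h :: chilbert_space op"
  assumes X: "\<And>i. X i \<in> bounded_ops"
  shows "row_norm (\<lambda>i. c *\<^sub>C X i) \<le> cmod c * row_norm X"
proof (rule row_norm_leI)
  fix \<xi> :: "'n \<Rightarrow> 'h" and \<eta>
  have "cmod (\<Sum>i\<in>UNIV. cinner (blinfun_apply (c *\<^sub>C X i) (\<xi> i)) \<eta>)
      = cmod c * cmod (\<Sum>i\<in>UNIV. cinner (blinfun_apply (X i) (\<xi> i)) \<eta>)"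
    by (simp add: scaleC_blinfun.rep_eq cinner_scaleC_left norm_mult flip: sum_distrib_left)
  also have "\<dots> \<le> cmod c * (row_norm X * L2_set (\<lambda>i. norm (\<xi> i)) UNIV * norm \<eta>)"
    by (intro mult_left_mono cmod_row_form_le X) auto
  finally show "cmod (\<Sum>i\<in>UNIV. cinner (blinfun_apply (c *\<^sub>C X i) (\<xi> i)) \<eta>)
      \<le> cmod c * row_norm X * L2_set (\<lambda>i. norm (\<xi> i)) UNIV * norm \<eta>"
    by (simp add: mult_ac)
qed (use X in \<open>auto simp: bounded_ops_scale row_norm_nonneg\<close>)

lemma row_norm_scaleR_le:
  fixes X :: "'n :: finite \<Rightarrow> 'h :: chilbert_space op"
  assumes "\<And>i. X i \<in> bounded_ops"
  shows "row_norm (\<lambda>i. r *\<^sub>R X i) \<le> \<bar>r\<bar> * row_norm X"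
  using row_norm_scaleC_le[of X "of_real r"] assms by (simp add: scaleC_of_real)

lemma scaleC_row_ball:
  fixes X :: "'n :: finite \<Rightarrow> 'h :: chilbert_space op"
  assumes X: "X \<in> row_cball" and z: "cmod z < 1"
  shows "(\<lambda>i. z *\<^sub>C X i) \<in> row_ball"
proof -
  have "row_norm (\<lambda>i. z *\<^sub>C X i) \<le> cmod z * row_norm X"
    using X by (intro row_norm_scaleC_le) (auto simp: row_cball_def)
  also have "\<dots> \<le> cmod z * 1"
    using X by (intro mult_left_mono) (auto simp: row_cball_def)
  finally show ?thesis
    using X z by (auto simp: row_ball_def row_cball_def bounded_ops_scale)
qed

section \<open>Free power series along a disc\<close>

lemma bounded_ops_word_op:
  "(\<And>i. X i \<in> bounded_ops) \<Longrightarrow> word_op X \<alpha> \<in> bounded_ops"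
  by (induction \<alpha>) (auto simp: bounded_ops_def)

lemma homogeneous_part_apply:
  "blinfun_apply (homogeneous_part a X k) x
    = (\<Sum>\<alpha> | length \<alpha> = k. a \<alpha> *\<^sub>C blinfun_apply (word_op X \<alpha>) x)"
  by (simp add: homogeneous_part_def blinfun.sum_left scaleC_blinfun.rep_eq)

lemma word_op_scaleC:
  fixes X :: "'n \<Rightarrow> 'h :: chilbert_space op"
  assumes "\<And>i. X i \<in> bounded_ops"
  shows "word_op (\<lambda>i. c *\<^sub>C X i) \<alpha> = c ^ length \<alpha> *\<^sub>C word_op X \<alpha>"
proof (induction \<alpha>)
  case (Cons i \<alpha>)
  show ?case
    by (rule blinfun_eqI)
      (simp add: Cons scaleC_blinfun.rep_eq bounded_ops_scaleC[OF assms] scaleC_scaleC)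
qed simp

lemma homogeneous_part_scaleC:
  fixes X :: "'n :: finite \<Rightarrow> 'h :: chilbert_space op"
  assumes "\<And>i. X i \<in> bounded_ops"
  shows "homogeneous_part a (\<lambda>i. c *\<^sub>C X i) k = c ^ k *\<^sub>C homogeneous_part a X k"
  unfolding homogeneous_part_def word_op_scaleC[OF assms] complex_vector.scale_sum_right
  by (intro sum.cong) (auto simp: scaleC_scaleC mult.commute)

text \<open>
  On the disc through X the free series is an ordinary power series whose coefficients are the
  matrix coefficients of its homogeneous parts. This carries one-variable function theory over.
\<close>

lemma slice_sums:
  fixes X :: "'n :: finite \<Rightarrow> 'h :: chilbert_space op"
  assumes f: "has_free_expansion f a" and X: "X \<in> row_cball" and z: "cmod z < 1"
  shows "(\<lambda>k. cinner (blinfun_apply (homogeneous_part a X k) \<xi>) \<eta> * z ^ k)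
    sums cinner (blinfun_apply (f (\<lambda>i. z *\<^sub>C X i)) \<xi>) \<eta>"
proof -
  have X': "\<And>i. X i \<in> bounded_ops"
    using X by (simp add: row_cball_def)
  have "bounded_linear (\<lambda>T. cinner (blinfun_apply T \<xi>) \<eta>)"
    by (rule bounded_linear_compose[OF bounded_linear_cinner_left blinfun.bounded_linear_left])
  from bounded_linear.sums[OF this f[unfolded has_free_expansion_def, rule_format, OF scaleC_row_ball[OF X z]]]
  show ?thesis
    by (simp add: homogeneous_part_scaleC[OF X'] scaleC_blinfun.rep_eq cinner_scaleC_left mult.commute)
qed

section \<open>The Schwarz--Pick inequality\<close>

lemma Schwarz_Pick_fraction_mono:
  fixes s t c d :: real
  assumes "0 \<le> s" "s \<le> t" "t \<le> 1" "0 \<le> c" "c \<le> d" "d \<le> 1"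
  shows "(s + c) / (1 + s * c) \<le> (t + d) / (1 + t * d)"
proof -
  have mono: "(a + b) / (1 + a * b) \<le> (a' + b) / (1 + a' * b)"
    if "0 \<le> a" "a \<le> a'" "0 \<le> b" "b \<le> 1" for a a' b :: real
  proof -
    have "0 \<le> (a' - a) * (1 - b * b)"
      using that by (intro mult_nonneg_nonneg) (auto simp: mult_le_one)
    hence "(a + b) * (1 + a' * b) \<le> (a' + b) * (1 + a * b)"
      by (simp add: algebra_simps)
    moreover have "0 < 1 + a * b" "0 < 1 + a' * b"
      using that by (auto intro!: add_pos_nonneg)
    ultimately show ?thesis
      by (simp add: frac_le_eq divide_simps)
  qed
  have "(s + c) / (1 + s * c) \<le> (t + c) / (1 + t * c)"
    by (rule mono) (use assms in auto)
  also have "\<dots> \<le> (t + d) / (1 + t * d)"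
    using mono[of c d t] assms by (simp add: add.commute mult.commute)
  finally show ?thesis .
qed

lemma Schwarz_Pick_strict:
  assumes hol: "h holomorphic_on ball 0 1" and less: "\<And>z. cmod z < 1 \<Longrightarrow> cmod (h z) < 1"
    and w: "cmod w < 1"
  shows "cmod (h w) \<le> (cmod w + cmod (h 0)) / (1 + cmod w * cmod (h 0))"
proof -
  define a where "a = h 0"
  define g where "g z = (h z - a) / (1 - cnj a * h z)" for z
  have a: "cmod a < 1"
    using less[of 0] by (simp add: a_def)
  have prod_less: "cmod (cnj a * h z) < 1" if "cmod z < 1" for z
    using mult_strict_mono'[OF a less[OF that]] by (simp add: norm_mult)
  hence nz: "1 - cnj a * h z \<noteq> 0" if "cmod z < 1" for z
    using that by (metis norm_one less_irrefl right_minus_eq)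
  \<comment> \<open>gives |g| < 1 for the Moebius quotient g\<close>
  have id: "(cmod (1 - cnj a * u))\<^sup>2 - (cmod (u - a))\<^sup>2 = (1 - (cmod a)\<^sup>2) * (1 - (cmod u)\<^sup>2)" for u
    unfolding cmod_power2 by (simp add: algebra_simps power2_eq_square)
  have "cmod (g w) \<le> cmod w"
  proof (rule Schwarz_Lemma(1))
    show "g holomorphic_on ball 0 1"
      unfolding g_def using nz by (intro holomorphic_intros hol) auto
    show "cmod (g z) < 1" if z: "cmod z < 1" for z
    proof -
      have "0 < (1 - (cmod a)\<^sup>2) * (1 - (cmod (h z))\<^sup>2)"
        using a less[OF z] by (intro mult_pos_pos) (auto simp: power_less_one_iff abs_square_less_1)
      hence "(cmod (h z - a))\<^sup>2 < (cmod (1 - cnj a * h z))\<^sup>2"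
        unfolding id[symmetric] by simp
      hence "cmod (h z - a) < cmod (1 - cnj a * h z)"
        by (rule power2_less_imp_less) simp
      thus ?thesis
        by (auto simp: g_def norm_divide divide_less_eq_1)
    qed
  qed (auto simp: g_def a_def w)
  hence "cmod (h w - a) \<le> cmod w * cmod (1 - cnj a * h w)"
    using nz[OF w] by (simp add: g_def norm_divide divide_simps)
  hence "(cmod (h w - a))\<^sup>2 \<le> (cmod w)\<^sup>2 * (cmod (1 - cnj a * h w))\<^sup>2"
    by (metis norm_ge_zero power_mono power_mult_distrib)
  \<comment> \<open>both squares contain the same real part of \<open>cnj a * h w\<close>, which is at most |a| |h w|\<close>
  moreover define p where "p = Re (cnj a * h w)"
  have "(cmod (h w - a))\<^sup>2 = (cmod (h w))\<^sup>2 - 2 * p + (cmod a)\<^sup>2"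
    unfolding cmod_power2 p_def by (simp add: algebra_simps power2_eq_square)
  moreover have "(cmod (1 - cnj a * h w))\<^sup>2 = 1 - 2 * p + (cmod a * cmod (h w))\<^sup>2"
    unfolding power_mult_distrib cmod_power2 p_def by (simp add: algebra_simps power2_eq_square)
  ultimately have ineq: "(cmod (h w))\<^sup>2 - 2 * p + (cmod a)\<^sup>2
      \<le> (cmod w)\<^sup>2 * (1 - 2 * p + (cmod a * cmod (h w))\<^sup>2)"
    by simp
  have "p \<le> cmod a * cmod (h w)"
    unfolding p_def by (metis complex_Re_le_cmod complex_mod_cnj norm_mult)
  moreover have w1: "(cmod w)\<^sup>2 \<le> 1"
    using w by (simp add: abs_square_le_1)
  ultimately have "(1 - (cmod w)\<^sup>2) * p \<le> (1 - (cmod w)\<^sup>2) * (cmod a * cmod (h w))"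
    by (intro mult_left_mono) auto
  with ineq have "(cmod (h w) - cmod a)\<^sup>2 \<le> (cmod w * (1 - cmod a * cmod (h w)))\<^sup>2"
    by (simp add: algebra_simps power2_eq_square)
  moreover have "cmod a * cmod (h w) \<le> 1"
    using prod_less[OF w] by (simp add: norm_mult)
  ultimately have "cmod (h w) - cmod a \<le> cmod w * (1 - cmod a * cmod (h w))"
    by (auto intro: power2_le_imp_le)
  hence "cmod (h w) * (1 + cmod w * cmod a) \<le> cmod w + cmod a"
    by (simp add: algebra_simps)
  moreover have "0 < 1 + cmod w * cmod a"
    by (simp add: add_pos_nonneg)
  ultimately show ?thesis
    by (simp add: a_def pos_le_divide_eq)
qed

text \<open>
  The strict inequality needed for the Moebius transformation is reached by shrinking the values;
  monotonicity of the bound absorbs the shrinking at the origin.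
\<close>

lemma Schwarz_Pick_bound:
  assumes hol: "h holomorphic_on ball 0 1" and le: "\<And>z. cmod z < 1 \<Longrightarrow> cmod (h z) \<le> M"
    and w: "cmod w < 1" and c: "0 \<le> c" "c \<le> 1" and h0: "cmod (h 0) \<le> c * M"
  shows "cmod (h w) \<le> (cmod w + c) / (1 + cmod w * c) * M"
proof (cases "M = 0")
  case True
  thus ?thesis
    using le[OF w] by simp
next
  case False
  have "0 \<le> M"
    using order_trans[OF norm_ge_zero le[of 0]] by simp
  with False have M: "0 < M"
    by simp
  define Q where "Q = (cmod w + c) / (1 + cmod w * c)"
  have "t * (cmod (h w) / M) \<le> Q" if t: "0 < t" "t < 1" for t
  proof -
    define g where "g z = of_real (t / M) * h z" for z
    have g: "cmod (g z) = t * (cmod (h z) / M)" for z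
      using t M by (simp add: g_def norm_mult norm_divide)
    have "cmod (g w) \<le> (cmod w + cmod (g 0)) / (1 + cmod w * cmod (g 0))"
    proof (rule Schwarz_Pick_strict)
      show "g holomorphic_on ball 0 1"
        unfolding g_def by (intro holomorphic_intros hol)
      show "cmod (g z) < 1" if "cmod z < 1" for z
      proof -
        have "t * (cmod (h z) / M) \<le> t * 1"
          using le[OF that] M t by (intro mult_left_mono) auto
        thus ?thesis
          using t g[of z] by simp
      qed
    qed (rule w)
    also have "\<dots> \<le> Q"
      unfolding Q_def
    proof (rule Schwarz_Pick_fraction_mono)
      have "t * (cmod (h 0) / M) \<le> 1 * (cmod (h 0) / M)"
        using t M by (intro mult_right_mono) auto
      also have "\<dots> \<le> c"
        using h0 M by (simp add: pos_divide_le_eq)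
      finally show "cmod (g 0) \<le> c"
        by (simp add: g)
    qed (use w c in auto)
    finally show ?thesis
      by (simp add: g)
  qed
  hence "cmod (h w) / M \<le> Q"
    by (rule field_le_mult_one_interval)
  thus ?thesis
    using M by (simp add: Q_def pos_divide_le_eq mult.commute)
qed

lemma row_norm_zero: "row_norm (\<lambda>_ :: 'n :: finite. 0 :: 'h :: chilbert_space op) = 0"
proof -
  have "row_norm (\<lambda>_ :: 'n. 0 :: 'h op) \<le> 0"
    by (rule row_norm_leI) (auto simp: bounded_ops_def)
  thus ?thesis
    using row_norm_nonneg[of "\<lambda>_ :: 'n. 0 :: 'h op"] by linarith
qed

text \<open>
  A unit direction is a closed disc in the row ball, and every matrix coefficient of the row F on
  that disc is a scalar holomorphic function to which the Schwarz--Pick inequality applies.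
\<close>

lemma row_norm_Schwarz_Pick:
  fixes F :: "('n :: finite \<Rightarrow> 'h :: chilbert_space op) \<Rightarrow> 'm :: finite \<Rightarrow> 'h op"
  assumes F: "free_holomorphic F" and ball: "F ` row_ball \<subseteq> row_cball" and X: "X \<in> row_ball"
  shows "row_norm (F X)
    \<le> (row_norm X + row_norm (F (\<lambda>_. 0))) / (1 + row_norm X * row_norm (F (\<lambda>_. 0)))"
proof (cases "row_norm X = 0")
  case True
  have "norm (X i) \<le> 0" for i
    using norm_entry_le_row_norm[of X i] X True by (auto simp: row_ball_def)
  hence "X = (\<lambda>_. 0)"
    by auto
  thus ?thesis
    by (simp add: row_norm_zero)
next
  case False
  define \<rho> where "\<rho> = row_norm X"
  have \<rho>: "0 < \<rho>" "\<rho> < 1"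
    using False row_norm_nonneg[of X] X by (auto simp: \<rho>_def row_ball_def)
  define c where "c = row_norm (F (\<lambda>_. 0))"
  define X' where "X' i = complex_of_real (1 / \<rho>) *\<^sub>C X i" for i
  have Xb: "\<And>i. X i \<in> bounded_ops"
    using X by (simp add: row_ball_def)
  have "row_norm X' \<le> cmod (of_real (1 / \<rho>)) * row_norm X"
    unfolding X'_def by (intro row_norm_scaleC_le Xb)
  also have "\<dots> = 1"
    using \<rho> by (simp add: \<rho>_def norm_divide)
  finally have X': "X' \<in> row_cball"
    using Xb by (auto simp: row_cball_def X'_def bounded_ops_scale)
  have FX: "F (\<lambda>i. z *\<^sub>C X' i) \<in> row_cball" if "cmod z < 1" for z
    using ball scaleC_row_ball[OF X' that] by blast
  have F0: "F (\<lambda>_. 0) \<in> row_cball"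
    using FX[of 0] by simp
  have c: "0 \<le> c" "c \<le> 1"
    using F0 by (auto simp: c_def row_norm_nonneg row_cball_def)
  have X_eq: "X = (\<lambda>i. of_real \<rho> *\<^sub>C X' i)"
    using \<rho> by (simp add: X'_def scaleC_scaleC of_real_mult[symmetric] del: of_real_mult of_real_divide)
  obtain a where a: "\<And>j. has_free_expansion (\<lambda>X. F X j) (a j)"
    using F unfolding free_holomorphic_def by metis
  have "row_norm (F X) \<le> (\<rho> + c) / (1 + \<rho> * c)"
  proof (rule row_norm_leI)
    show "F X j \<in> bounded_ops" for j
      using ball X by (auto simp: row_cball_def)
    show "0 \<le> (\<rho> + c) / (1 + \<rho> * c)"
      using \<rho> c by (intro divide_nonneg_nonneg) auto
    fix \<xi> :: "'m \<Rightarrow> 'h" and \<eta> :: 'h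
    define h where "h z = (\<Sum>j\<in>UNIV. cinner (blinfun_apply (F (\<lambda>i. z *\<^sub>C X' i) j) (\<xi> j)) \<eta>)" for z
    define M where "M = L2_set (\<lambda>j. norm (\<xi> j)) UNIV * norm \<eta>"
    have M: "0 \<le> M"
      by (simp add: M_def)
    have h_le: "cmod (h z) \<le> row_norm (F (\<lambda>i. z *\<^sub>C X' i)) * M" if "cmod z < 1" for z
      unfolding h_def M_def mult.assoc[symmetric]
      using FX[OF that] by (intro cmod_row_form_le) (simp add: row_cball_def)
    have "cmod (h (of_real \<rho>)) \<le> (cmod (of_real \<rho>) + c) / (1 + cmod (of_real \<rho>) * c) * M"
    proof (rule Schwarz_Pick_bound)
      show "h holomorphic_on ball 0 1"
      proof (rule power_series_holomorphic)
        fix z :: complex assume "z \<in> ball 0 1"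
        hence "(\<lambda>k. \<Sum>j\<in>UNIV. cinner (blinfun_apply (homogeneous_part (a j) X' k) (\<xi> j)) \<eta> * z ^ k) sums h z"
          unfolding h_def by (intro sums_sum slice_sums[OF a X']) auto
        thus "(\<lambda>k. (\<Sum>j\<in>UNIV. cinner (blinfun_apply (homogeneous_part (a j) X' k) (\<xi> j)) \<eta>) * (z - 0) ^ k) sums h z"
          by (simp add: sum_distrib_right)
      qed
      show "cmod (h z) \<le> M" if "cmod z < 1" for z
        using h_le[OF that] FX[OF that] M
          mult_right_mono[of "row_norm (F (\<lambda>i. z *\<^sub>C X' i))" 1 M] by (simp add: row_cball_def)
      show "cmod (h 0) \<le> c * M"
        using h_le[of 0] by (simp add: c_def)
    qed (use \<rho> c in auto)
    thus "cmod (\<Sum>j\<in>UNIV. cinner (blinfun_apply (F X j) (\<xi> j)) \<eta>)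
        \<le> (\<rho> + c) / (1 + \<rho> * c) * L2_set (\<lambda>j. norm (\<xi> j)) UNIV * norm \<eta>"
      unfolding h_def M_def X_eq[symmetric] using \<rho> by (simp add: mult.assoc)
  qed
  thus ?thesis
    by (simp add: \<rho>_def c_def)
qed

section \<open>Orthonormal sets for semi-definite forms\<close>

text \<open>
  Positive semi-definite forms are treated at the same time as inner products because the defect form
  of a row contraction, x, y \<mapsto> <x, y> - \<Sum> <X_i^* x, X_i^* y>, need not be definite.
\<close>

locale semi_inner =
  fixes D :: "'a :: complex_vector \<Rightarrow> 'a \<Rightarrow> complex"
  assumes add_left: "D (x + y) z = D x z + D y z"
    and scaleC_left: "D (c *\<^sub>C x) y = c * D x y"
    and hermitian: "D x y = cnj (D y x)"
    and nonneg: "0 \<le> Re (D x x)"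
begin

lemma add_right: "D x (y + z) = D x y + D x z"
  by (metis add_left hermitian complex_cnj_add)

lemma scaleC_right: "D x (c *\<^sub>C y) = cnj c * D x y"
  by (metis scaleC_left hermitian complex_cnj_mult)

lemma zero_left: "D 0 y = 0"
  using scaleC_left[of 0 0 y] by simp

lemma diff_left: "D (x - y) z = D x z - D y z"
  using add_left[of "x - y" y z] by simp

lemma diff_right: "D x (y - z) = D x y - D x z"
  using add_right[of x "y - z" z] by simp

lemma sum_left: "D (\<Sum>i\<in>I. f i) y = (\<Sum>i\<in>I. D (f i) y)"
  by (induction I rule: infinite_finite_induct) (auto simp: add_left zero_left)

lemma sum_right: "D x (\<Sum>i\<in>I. f i) = (\<Sum>i\<in>I. D x (f i))"
  by (subst hermitian, subst sum_left, subst cnj_sum) (simp flip: hermitian)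

lemma self_real: "D x x = of_real (Re (D x x))"
  using hermitian[of x x] by (simp add: complex_eq_iff)

definition orthonormal :: "'a set \<Rightarrow> bool" where
  "orthonormal E \<longleftrightarrow> finite E \<and> (\<forall>e\<in>E. \<forall>f\<in>E. D e f = (if e = f then 1 else 0))"

definition residual :: "'a set \<Rightarrow> 'a \<Rightarrow> 'a" where
  "residual E x = x - (\<Sum>e\<in>E. D x e *\<^sub>C e)"

lemma orthonormal_sum:
  assumes E: "orthonormal E" "e \<in> E"
  shows "D (\<Sum>f\<in>E. c f *\<^sub>C f) e = c e"
proof -
  have "D (\<Sum>f\<in>E. c f *\<^sub>C f) e = (\<Sum>f\<in>E. if f = e then c f else 0)"
    unfolding sum_left scaleC_left using E by (intro sum.cong) (auto simp: orthonormal_def)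
  also have "\<dots> = c e"
    using E by (simp add: orthonormal_def)
  finally show ?thesis .
qed

lemma residual_orthogonal: "orthonormal E \<Longrightarrow> e \<in> E \<Longrightarrow> D (residual E x) e = 0"
  by (simp add: residual_def diff_left orthonormal_sum)

lemma orthogonal_residual: "orthonormal E \<Longrightarrow> e \<in> E \<Longrightarrow> D e (residual E x) = 0"
  using residual_orthogonal hermitian by (metis complex_cnj_zero)

lemma self_residual:
  assumes "orthonormal E"
  shows "D x (residual E x) = D (residual E x) (residual E x)"
proof -
  have "D (\<Sum>e\<in>E. D x e *\<^sub>C e) (residual E x) = 0"
    unfolding sum_left scaleC_left using orthogonal_residual[OF assms] by simp
  thus ?thesis
    by (subst (2) residual_def) (simp add: diff_left)
qed

lemma residual_self:
  assumes "orthonormal E"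
  shows "Re (D (residual E x) (residual E x)) = Re (D x x) - (\<Sum>e\<in>E. (cmod (D x e))\<^sup>2)"
proof -
  have "cnj (D x e) * D x e = of_real ((cmod (D x e))\<^sup>2)" for e
    by (simp only: complex_norm_square mult.commute)
  hence "D x (residual E x) = D x x - of_real (\<Sum>e\<in>E. (cmod (D x e))\<^sup>2)"
    by (simp add: residual_def diff_right sum_right scaleC_right)
  thus ?thesis
    by (simp flip: self_residual[OF assms])
qed

lemma Bessel: "orthonormal E \<Longrightarrow> (\<Sum>e\<in>E. (cmod (D x e))\<^sup>2) \<le> Re (D x x)"
  using residual_self[of E x] nonneg[of "residual E x"] by simp

lemma orthonormal_extend:
  assumes E: "orthonormal E" and pos: "0 < Re (D (residual E x) (residual E x))"
  obtains e where "e \<notin> E" "orthonormal (insert e E)"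
    "Re (D x x) = (\<Sum>f\<in>insert e E. (cmod (D x f))\<^sup>2)"
proof -
  define r where "r = residual E x"
  define s where "s = sqrt (Re (D r r))"
  define e where "e = complex_of_real (1 / s) *\<^sub>C r"
  have s: "0 < s" and s2: "Re (D r r) = s * s"
    using pos by (auto simp: s_def r_def)
  have Drr: "D r r = of_real (s * s)"
    using self_real[of r] s2 by simp
  have Dee: "D e e = 1"
    using s by (simp add: e_def scaleC_left scaleC_right Drr field_simps)
  have Def: "D e f = 0" "D f e = 0" if "f \<in> E" for f
    using residual_orthogonal[OF E that] orthogonal_residual[OF E that]
    by (simp_all add: e_def scaleC_left scaleC_right r_def)
  have notin: "e \<notin> E"
    using Def Dee by force
  have on: "orthonormal (insert e E)"
    using E Def Dee unfolding orthonormal_def by auto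
  have "D x e = of_real s"
    using s self_residual[OF E, of x] by (simp add: e_def scaleC_right Drr flip: r_def)
  hence "(\<Sum>f\<in>insert e E. (cmod (D x f))\<^sup>2) = s * s + (\<Sum>f\<in>E. (cmod (D x f))\<^sup>2)"
    using E notin by (simp add: orthonormal_def power2_eq_square)
  hence "Re (D x x) = (\<Sum>f\<in>insert e E. (cmod (D x f))\<^sup>2)"
    using residual_self[OF E, of x] s2 by (simp add: r_def)
  with notin on show ?thesis
    by (rule that)
qed

lemma Parseval_mono:
  assumes "orthonormal E'" "E \<subseteq> E'" "Re (D x x) = (\<Sum>e\<in>E. (cmod (D x e))\<^sup>2)"
  shows "Re (D x x) = (\<Sum>e\<in>E'. (cmod (D x e))\<^sup>2)"
proof (rule antisym)
  show "Re (D x x) \<le> (\<Sum>e\<in>E'. (cmod (D x e))\<^sup>2)"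
    unfolding assms(3) using assms(1,2) by (intro sum_mono2) (auto simp: orthonormal_def)
qed (rule Bessel[OF assms(1)])

text \<open>
  Vectors of W are added one at a time: the residual of the next one is normalised if it has positive
  length. Otherwise Parseval's identity holds for that vector already, although the residual may be
  non-zero.
\<close>

lemma Gram_Schmidt:
  assumes "finite W"
  shows "\<exists>E. orthonormal E \<and> (\<forall>x\<in>W. Re (D x x) = (\<Sum>e\<in>E. (cmod (D x e))\<^sup>2))"
  using assms
proof induction
  case empty
  have "orthonormal {}"
    by (simp add: orthonormal_def)
  thus ?case
    by blast
next
  case (insert x W)
  then obtain E where E: "orthonormal E" "\<And>y. y \<in> W \<Longrightarrow> Re (D y y) = (\<Sum>e\<in>E. (cmod (D y e))\<^sup>2)"
    by blast
  show ?case
  proof (cases "0 < Re (D (residual E x) (residual E x))")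
    case True
    obtain e where e: "orthonormal (insert e E)" "Re (D x x) = (\<Sum>f\<in>insert e E. (cmod (D x f))\<^sup>2)"
      using orthonormal_extend[OF E(1) True] by blast
    have "\<forall>y\<in>insert x W. Re (D y y) = (\<Sum>f\<in>insert e E. (cmod (D y f))\<^sup>2)"
      using e(2) Parseval_mono[OF e(1) _ E(2)] by blast
    with e(1) show ?thesis
      by blast
  next
    case False
    hence "Re (D x x) = (\<Sum>e\<in>E. (cmod (D x e))\<^sup>2)"
      using nonneg[of "residual E x"] residual_self[OF E(1), of x] by simp
    with E show ?thesis
      by blast
  qed
qed

end

interpretation cinner: semi_inner "cinner :: 'h :: chilbert_space \<Rightarrow> 'h \<Rightarrow> complex"
  by standard (auto simp: cinner_add_left cinner_scaleC_left cinner_self intro: cinner_commute)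

lemma Bessel_family:
  fixes b :: "'i \<Rightarrow> 'h :: chilbert_space"
  assumes "finite A" and on: "\<And>i j. i \<in> A \<Longrightarrow> j \<in> A \<Longrightarrow> cinner (b i) (b j) = (if i = j then 1 else 0)"
  shows "(\<Sum>i\<in>A. (cmod (cinner x (b i)))\<^sup>2) \<le> (norm x)\<^sup>2"
proof -
  have inj: "inj_on b A"
    using on by (metis inj_onI zero_neq_one)
  have "cinner.orthonormal (b ` A)"
    using assms inj by (auto simp: cinner.orthonormal_def inj_on_eq_iff)
  from cinner.Bessel[OF this, of x] show ?thesis
    by (simp add: sum.reindex[OF inj] norm_sq_cinner)
qed

lemma norm_orthonormal_sum:
  fixes b :: "'i \<Rightarrow> 'h :: chilbert_space"
  assumes "finite A" and on: "\<And>i j. i \<in> A \<Longrightarrow> j \<in> A \<Longrightarrow> cinner (b i) (b j) = (if i = j then 1 else 0)"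
  shows "(norm (\<Sum>i\<in>A. c i *\<^sub>C b i))\<^sup>2 = (\<Sum>i\<in>A. (cmod (c i))\<^sup>2)"
proof -
  have "cinner (\<Sum>i\<in>A. c i *\<^sub>C b i) (\<Sum>i\<in>A. c i *\<^sub>C b i)
      = (\<Sum>i\<in>A. \<Sum>j\<in>A. c i * (cnj (c j) * cinner (b i) (b j)))"
    unfolding cinner_sum_left cinner_scaleC_left
    by (simp add: cinner_sum_right cinner_scaleC_right sum_distrib_left)
  also have "\<dots> = (\<Sum>i\<in>A. \<Sum>j\<in>A. if i = j then c i * cnj (c i) else 0)"
    by (intro sum.cong refl) (simp add: on)
  also have "\<dots> = (\<Sum>i\<in>A. of_real ((cmod (c i))\<^sup>2))"
    using assms(1) by (simp only: complex_norm_square sum.delta' if_True cong: sum.cong)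
  finally show ?thesis
    by (simp add: norm_sq_cinner)
qed

lemma exists_orthonormal_of_card:
  assumes inf: "\<not> (\<exists>B :: 'h :: chilbert_space set. finite B \<and> complex_vector.span B = UNIV)"
  shows "\<exists>E :: 'h set. cinner.orthonormal E \<and> card E = n"
proof (induction n)
  case 0
  have "cinner.orthonormal ({} :: 'h set)"
    by (simp add: cinner.orthonormal_def)
  thus ?case
    by (intro exI[of _ "{}"]) simp
next
  case (Suc n)
  then obtain E :: "'h set" where E: "cinner.orthonormal E" "card E = n"
    by blast
  hence fin: "finite E"
    by (simp add: cinner.orthonormal_def)
  then obtain x where x: "x \<notin> complex_vector.span E"
    using inf by blast
  have "cinner.residual E x \<noteq> 0"
  proof
    assume "cinner.residual E x = 0"
    hence "x = (\<Sum>e\<in>E. cinner x e *\<^sub>C e)"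
      by (simp add: cinner.residual_def)
    also have "\<dots> \<in> complex_vector.span E"
      by (intro complex_vector.span_sum complex_vector.span_scale complex_vector.span_base)
    finally show False
      using x by simp
  qed
  hence "0 < Re (cinner (cinner.residual E x) (cinner.residual E x))"
    by (simp flip: norm_sq_cinner)
  then obtain e where "e \<notin> E" "cinner.orthonormal (insert e E)"
    using cinner.orthonormal_extend[OF E(1)] by blast
  thus ?case
    using E fin by (intro exI[of _ "insert e E"]) simp
qed

section \<open>Bounds for the coefficients\<close>

text \<open>The Cauchy estimates on the circles of radius r, in the limit r \<longlonglongrightarrow> 1.\<close>

lemma power_series_coeff_le:
  fixes c :: "nat \<Rightarrow> complex"
  assumes sums: "\<And>z. cmod z < 1 \<Longrightarrow> (\<lambda>n. c n * z ^ n) sums h z"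
    and le: "\<And>z. cmod z < 1 \<Longrightarrow> cmod (h z) \<le> M"
  shows "cmod (c n) \<le> M"
proof -
  define e where "e = eval_fps (Abs_fps c)"
  have e: "e z = h z" if "cmod z < 1" for z
    using sums[OF that] by (simp add: e_def eval_fps_def sums_iff)
  have "1 \<le> conv_radius c"
  proof (rule conv_radius_geI_ex)
    fix r :: real assume r: "0 < r" "ereal r < 1"
    hence "summable (\<lambda>n. c n * of_real r ^ n)"
      using sums[of "of_real r"] by (auto simp: sums_iff)
    thus "\<exists>z. norm z = r \<and> summable (\<lambda>n. c n * z ^ n)"
      using r by (intro exI[of _ "of_real r"]) auto
  qed
  hence radius: "1 \<le> fps_conv_radius (Abs_fps c)"
    by (simp add: fps_conv_radius_def)
  hence "0 < fps_conv_radius (Abs_fps c)"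
    by (auto intro: less_le_trans[of _ 1])
  from fps_nth_conv_deriv[OF this, of n]
  have deriv: "(deriv ^^ n) e 0 = fact n * c n"
    by (simp add: e_def)
  have hol: "e holomorphic_on ball 0 1"
  proof (rule power_series_holomorphic)
    show "(\<lambda>n. c n * (w - 0) ^ n) sums e w" if "w \<in> ball 0 1" for w
      using that sums[of w] e[of w] by simp
  qed
  have est: "r ^ n * cmod (c n) \<le> M" if r: "0 < r" "r < 1" for r
  proof -
    have "cmod ((deriv ^^ n) e 0) \<le> fact n * M / r ^ n"
    proof (rule Cauchy_inequality)
      show "e holomorphic_on ball 0 r"
        using r by (intro holomorphic_on_subset[OF hol]) auto
      show "continuous_on (cball 0 r) e"
        using r by (intro holomorphic_on_imp_continuous_on holomorphic_on_subset[OF hol]) auto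
      show "cmod (e x) \<le> M" if "cmod (0 - x) = r" for x
        using that r le[of x] e[of x] by simp
    qed (use r in auto)
    thus ?thesis
      using r by (simp add: deriv norm_mult field_simps)
  qed
  have "((\<lambda>r. r ^ n * cmod (c n)) \<longlongrightarrow> 1 ^ n * cmod (c n)) (at_left (1 :: real))"
    by (intro tendsto_intros)
  moreover have "\<forall>\<^sub>F r in at_left (1 :: real). r ^ n * cmod (c n) \<le> M"
    using eventually_at_left_real[OF zero_less_one] by eventually_elim (use est in auto)
  ultimately have "1 ^ n * cmod (c n) \<le> M"
    by (rule tendsto_upperbound) simp
  thus ?thesis
    by simp
qed

lemma norm_homogeneous_part_le:
  fixes f :: "('n :: finite \<Rightarrow> 'h :: chilbert_space op) \<Rightarrow> 'h op" and X :: "'n \<Rightarrow> 'h op"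
  assumes f: "has_free_expansion f a" and le: "\<And>Y. Y \<in> row_ball \<Longrightarrow> norm (f Y) \<le> 1"
    and X: "X \<in> row_cball"
  shows "norm (homogeneous_part a X k) \<le> 1"
proof (rule norm_blinfun_bound)
  fix \<xi> :: 'h
  define \<eta> where "\<eta> = blinfun_apply (homogeneous_part a X k) \<xi>"
  have "cmod (cinner (blinfun_apply (homogeneous_part a X k) \<xi>) \<eta>) \<le> norm \<xi> * norm \<eta>"
  proof (rule power_series_coeff_le)
    show "(\<lambda>k. cinner (blinfun_apply (homogeneous_part a X k) \<xi>) \<eta> * z ^ k)
        sums cinner (blinfun_apply (f (\<lambda>i. z *\<^sub>C X i)) \<xi>) \<eta>" if "cmod z < 1" for z
      by (rule slice_sums[OF f X that])
    fix z :: complex assume z: "cmod z < 1"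
    let ?T = "f (\<lambda>i. z *\<^sub>C X i)"
    have "cmod (cinner (blinfun_apply ?T \<xi>) \<eta>) \<le> norm (blinfun_apply ?T \<xi>) * norm \<eta>"
      by (rule cmod_cinner_le)
    also have "\<dots> \<le> (norm ?T * norm \<xi>) * norm \<eta>"
      by (intro mult_right_mono norm_blinfun) auto
    also have "\<dots> \<le> (1 * norm \<xi>) * norm \<eta>"
      by (intro mult_right_mono le scaleC_row_ball[OF X z]) auto
    finally show "cmod (cinner (blinfun_apply ?T \<xi>) \<eta>) \<le> norm \<xi> * norm \<eta>"
      by simp
  qed
  thus "norm (blinfun_apply (homogeneous_part a X k) \<xi>) \<le> 1 * norm \<xi>"
    unfolding \<eta>_def[symmetric] by (intro norm_le_if_cinner_le) auto
qed simp

lemma finite_words [simp]: "finite {\<alpha> :: 'n :: finite list. length \<alpha> = k}"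
  using finite_lists_length_eq[of "UNIV :: 'n set" k] by simp

lemma finite_short_words [simp]: "finite {\<alpha> :: 'n :: finite list. length \<alpha> < k}"
  using finite_lists_length_le[of "UNIV :: 'n set" k] by (rule rev_finite_subset) auto

text \<open>
  A family of orthonormal vectors indexed by the words of length at most k carries a copy of the
  creation operators truncated at length k, X_i = \<Sum> <., b_w> b_(i # w) over the words w shorter than
  k. Finite rank makes boundedness immediate, and Bessel's inequality bounds the row norm.
\<close>

lemma truncated_creation_operators:
  fixes b :: "'n :: finite list \<Rightarrow> 'h :: chilbert_space"
  assumes on: "\<And>v w. length v \<le> k \<Longrightarrow> length w \<le> k \<Longrightarrow> cinner (b v) (b w) = (if v = w then 1 else 0)"
  shows "\<exists>X\<in>row_cball. \<forall>\<alpha>. length \<alpha> \<le> k \<longrightarrow> blinfun_apply (word_op X \<alpha>) (b []) = b \<alpha>"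
proof -
  define g where "g i x = (\<Sum>w | length w < k. cinner x (b w) *\<^sub>C b (i # w))" for i x
  have "bounded_linear (g i)" for i
  proof -
    have "bounded_linear (\<lambda>x. c x *\<^sub>C v)" if "bounded_linear c" for c :: "'h \<Rightarrow> complex" and v :: 'h
    proof -
      interpret c: bounded_linear c by (rule that)
      obtain K where K: "\<And>x. norm (c x) \<le> norm x * K"
        using c.bounded by blast
      show ?thesis
      proof (rule bounded_linear_intro[where K = "K * norm v"])
        show "norm (c x *\<^sub>C v) \<le> norm x * (K * norm v)" for x
          using mult_right_mono[OF K, of "norm v"] by (simp add: norm_scaleC mult.assoc)
        show "c (r *\<^sub>R x) *\<^sub>C v = r *\<^sub>R (c x *\<^sub>C v)" for r x
          unfolding c.scaleR by (simp only: scaleR_conv_of_real scaleC_of_real[symmetric] scaleC_scaleC)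
      qed (simp add: c.add scaleC_add_left)
    qed
    from this[OF bounded_linear_cinner_left] show ?thesis
      unfolding g_def by (intro bounded_linear_sum)
  qed
  define X where "X i = Blinfun (g i)" for i
  have X_apply: "blinfun_apply (X i) x = g i x" for i x
    by (simp add: X_def bounded_linear_Blinfun_apply \<open>bounded_linear (g i)\<close>)
  have X_ops: "X i \<in> bounded_ops" for i
    by (rule bounded_opsI)
      (simp add: X_apply g_def cinner_scaleC_left complex_vector.scale_sum_right scaleC_scaleC)
  have "row_norm X \<le> 1"
  proof (rule row_norm_leI)
    fix \<xi> :: "'n \<Rightarrow> 'h" and \<eta>
    let ?I = "(UNIV :: 'n set) \<times> {w :: 'n list. length w < k}"
    let ?p = "\<lambda>(i, w). cmod (cinner (\<xi> i) (b w))" and ?q = "\<lambda>(i, w). cmod (cinner \<eta> (b (i # w)))"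
    have "(L2_set ?p ?I)\<^sup>2 = (\<Sum>i\<in>UNIV. \<Sum>w | length w < k. (cmod (cinner (\<xi> i) (b w)))\<^sup>2)"
      unfolding L2_set_power2 sum.cartesian_product by (intro sum.cong) auto
    also have "\<dots> \<le> (\<Sum>i\<in>UNIV. (norm (\<xi> i))\<^sup>2)"
      by (intro sum_mono Bessel_family on) auto
    finally have "(L2_set ?p ?I)\<^sup>2 \<le> (L2_set (\<lambda>i. norm (\<xi> i)) UNIV)\<^sup>2"
      unfolding L2_set_power2 .
    hence p: "L2_set ?p ?I \<le> L2_set (\<lambda>i. norm (\<xi> i)) UNIV"
      by (rule power2_le_imp_le) simp
    have "(L2_set ?q ?I)\<^sup>2 = (\<Sum>(i, w)\<in>?I. (cmod (cinner \<eta> (b (i # w))))\<^sup>2)"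
      unfolding L2_set_power2 by (intro sum.cong) auto
    also have "\<dots> = (\<Sum>x\<in>?I. (cmod (cinner \<eta> (b (fst x # snd x))))\<^sup>2)"
      by (simp add: case_prod_unfold)
    also have "\<dots> \<le> (norm \<eta>)\<^sup>2"
      by (rule Bessel_family) (auto simp: on split: if_splits)
    finally have q: "L2_set ?q ?I \<le> norm \<eta>"
      by (rule power2_le_imp_le) simp
    have "(\<Sum>i\<in>UNIV. cinner (blinfun_apply (X i) (\<xi> i)) \<eta>)
        = (\<Sum>(i, w)\<in>?I. cinner (\<xi> i) (b w) * cinner (b (i # w)) \<eta>)"
      unfolding sum.cartesian_product[symmetric]
      by (simp add: X_apply g_def cinner_sum_left cinner_scaleC_left)
    also have "cmod \<dots> \<le> (\<Sum>x\<in>?I. \<bar>?p x\<bar> * \<bar>?q x\<bar>)"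
    proof (intro sum_norm_le)
      fix x assume "x \<in> ?I"
      have "cmod (cinner (b (fst x # snd x)) \<eta>) = cmod (cinner \<eta> (b (fst x # snd x)))"
        by (subst cinner_commute) simp
      thus "cmod (case x of (i, w) \<Rightarrow> cinner (\<xi> i) (b w) * cinner (b (i # w)) \<eta>) \<le> \<bar>?p x\<bar> * \<bar>?q x\<bar>"
        by (simp add: case_prod_unfold norm_mult)
    qed
    also have "\<dots> \<le> L2_set ?p ?I * L2_set ?q ?I"
      by (rule L2_set_mult_ineq)
    also have "\<dots> \<le> L2_set (\<lambda>i. norm (\<xi> i)) UNIV * norm \<eta>"
      by (intro mult_mono p q) auto
    finally show "cmod (\<Sum>i\<in>UNIV. cinner (blinfun_apply (X i) (\<xi> i)) \<eta>)
        \<le> 1 * L2_set (\<lambda>i. norm (\<xi> i)) UNIV * norm \<eta>"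
      by simp
  qed (auto simp: X_ops)
  moreover have "blinfun_apply (word_op X \<alpha>) (b []) = b \<alpha>" if "length \<alpha> \<le> k" for \<alpha>
    using that
  proof (induction \<alpha>)
    case (Cons i \<alpha>)
    have "g i (b \<alpha>) = (\<Sum>w | length w < k. (if \<alpha> = w then 1 else 0) *\<^sub>C b (i # w))"
      unfolding g_def using Cons.prems by (intro sum.cong) (auto simp: on)
    also have "\<dots> = (\<Sum>w | length w < k. if \<alpha> = w then b (i # w) else 0)"
      by (intro sum.cong) auto
    also have "\<dots> = b (i # \<alpha>)"
      using Cons.prems by simp
    finally show ?case
      using Cons by (simp add: X_apply)
  qed simp
  ultimately show ?thesis
    using X_ops by (intro bexI[of _ X]) (auto simp: row_cball_def)
qed

text \<open>
  The homogeneous part of degree k, a contraction by the Cauchy estimates, sends the unit vector of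
  the empty word to the vector with coordinates a_\<alpha> for the words \<alpha> of length k.
\<close>

lemma sum_coefficients_le:
  fixes f :: "('n :: finite \<Rightarrow> 'h :: chilbert_space op) \<Rightarrow> 'h op"
  assumes inf: "\<not> (\<exists>B :: 'h set. finite B \<and> complex_vector.span B = UNIV)"
    and f: "has_free_expansion f a" and le: "\<And>Y. Y \<in> row_ball \<Longrightarrow> norm (f Y) \<le> 1"
  shows "(\<Sum>\<alpha> | length \<alpha> = k. (cmod (a \<alpha>))\<^sup>2) \<le> 1"
proof -
  let ?W = "{w :: 'n list. length w < Suc k}"
  obtain E :: "'h set" where E: "cinner.orthonormal E" "card E = card ?W"
    using exists_orthonormal_of_card[OF inf] by blast
  obtain b where b: "bij_betw b ?W E"
    using E finite_same_card_bij[of ?W E] by (auto simp: cinner.orthonormal_def)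
  have on: "cinner (b v) (b w) = (if v = w then 1 else 0)" if "length v \<le> k" "length w \<le> k" for v w
    using that E(1) b unfolding cinner.orthonormal_def bij_betw_def
    by (auto simp: inj_on_eq_iff less_Suc_eq_le)
  obtain X where X: "X \<in> row_cball"
      "\<And>\<alpha>. length \<alpha> \<le> k \<Longrightarrow> blinfun_apply (word_op X \<alpha>) (b []) = b \<alpha>"
    using truncated_creation_operators[OF on] by blast
  define v where "v = (\<Sum>\<alpha> | length \<alpha> = k. a \<alpha> *\<^sub>C b \<alpha>)"
  have "v = blinfun_apply (homogeneous_part a X k) (b [])"
    by (simp add: v_def homogeneous_part_apply X(2))
  hence "norm v \<le> norm (homogeneous_part a X k) * norm (b [])"
    by (simp add: norm_blinfun)
  also have "\<dots> \<le> 1 * 1"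
  proof (intro mult_mono norm_homogeneous_part_le[OF f le X(1)])
    have "(norm (b []))\<^sup>2 \<le> 1\<^sup>2"
      by (simp add: norm_sq_cinner on)
    thus "norm (b []) \<le> 1"
      by (rule power2_le_imp_le) simp
  qed auto
  finally have "(norm v)\<^sup>2 \<le> 1"
    by (simp add: power_le_one)
  moreover have "(norm v)\<^sup>2 = (\<Sum>\<alpha> | length \<alpha> = k. (cmod (a \<alpha>))\<^sup>2)"
    unfolding v_def by (rule norm_orthonormal_sum) (auto simp: on)
  ultimately show ?thesis
    by simp
qed

section \<open>Adjoints of words in a row contraction\<close>

text \<open>
  The adjoint of X_\<alpha> reverses the word, so the letters of \<alpha> act in reading order, the first one first.
\<close>

primrec word_adj :: "('n \<Rightarrow> 'h :: chilbert_space op) \<Rightarrow> 'n list \<Rightarrow> 'h \<Rightarrow> 'h" where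
  "word_adj X [] y = y"
| "word_adj X (i # \<alpha>) y = word_adj X \<alpha> (blinfun_apply (adj (X i)) y)"

lemma word_adj_append: "word_adj X (\<alpha> @ \<beta>) y = word_adj X \<beta> (word_adj X \<alpha> y)"
  by (induction \<alpha> arbitrary: y) auto

lemma cinner_word_op:
  assumes "\<And>i. X i \<in> bounded_ops"
  shows "cinner (blinfun_apply (word_op X \<alpha>) x) y = cinner x (word_adj X \<alpha> y)"
  by (induction \<alpha> arbitrary: y) (auto simp: cinner_adj[OF assms])

lemma word_adj_sum: "word_adj X \<alpha> (\<Sum>i\<in>I. f i) = (\<Sum>i\<in>I. word_adj X \<alpha> (f i))"
  by (induction \<alpha> arbitrary: f) (auto simp: blinfun.sum_right)

lemma word_adj_scaleC:
  assumes "\<And>i. X i \<in> bounded_ops"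
  shows "word_adj X \<alpha> (c *\<^sub>C y) = c *\<^sub>C word_adj X \<alpha> y"
  by (induction \<alpha> arbitrary: y) (auto simp: adj_scaleC[OF assms])

lemma sum_words_Suc:
  fixes g :: "'n :: finite list \<Rightarrow> 'b :: comm_monoid_add"
  shows "(\<Sum>\<alpha> | length \<alpha> = Suc k. g \<alpha>) = (\<Sum>\<alpha> | length \<alpha> = k. \<Sum>i\<in>UNIV. g (\<alpha> @ [i]))"
proof -
  have "butlast \<alpha> @ [last \<alpha>] = \<alpha>" if "length \<alpha> = Suc k" for \<alpha> :: "'n list"
    using that by (cases \<alpha> rule: rev_cases) auto
  thus ?thesis
    unfolding sum.cartesian_product
    by (intro sum.reindex_bij_witness[of _ "\<lambda>(\<alpha>, i). \<alpha> @ [i]" "\<lambda>\<alpha>. (butlast \<alpha>, last \<alpha>)"]) auto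
qed

lemma sum_word_adj_le:
  fixes X :: "'n :: finite \<Rightarrow> 'h :: chilbert_space op"
  assumes X: "\<And>i. X i \<in> bounded_ops"
  shows "(\<Sum>\<alpha> | length \<alpha> = k. (norm (word_adj X \<alpha> y))\<^sup>2) \<le> (row_norm X ^ k * norm y)\<^sup>2"
proof (induction k)
  case (Suc k)
  have "(\<Sum>\<alpha> | length \<alpha> = Suc k. (norm (word_adj X \<alpha> y))\<^sup>2)
      = (\<Sum>\<alpha> | length \<alpha> = k. (L2_set (\<lambda>i. norm (blinfun_apply (adj (X i)) (word_adj X \<alpha> y))) UNIV)\<^sup>2)"
    by (simp add: sum_words_Suc word_adj_append L2_set_power2)
  also have "\<dots> \<le> (\<Sum>\<alpha> | length \<alpha> = k. (row_norm X * norm (word_adj X \<alpha> y))\<^sup>2)"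
    by (intro sum_mono power_mono L2_set_adj_le X) auto
  also have "\<dots> = (row_norm X)\<^sup>2 * (\<Sum>\<alpha> | length \<alpha> = k. (norm (word_adj X \<alpha> y))\<^sup>2)"
    by (simp add: power_mult_distrib sum_distrib_left)
  also have "\<dots> \<le> (row_norm X)\<^sup>2 * (row_norm X ^ k * norm y)\<^sup>2"
    by (intro mult_left_mono Suc) auto
  finally show ?case
    by (simp add: power_mult_distrib mult_ac)
qed simp

text \<open>
  The operators X_\<alpha> with \<alpha> of length k form a row of norm at most |X|^k. Applied to a column of scalars,
  such a row costs only the Euclidean norm of the column, so the number of words does not enter.
\<close>

lemma norm_homogeneous_part_row_le:
  fixes X :: "'n :: finite \<Rightarrow> 'h :: chilbert_space op"
  assumes X: "\<And>i. X i \<in> bounded_ops"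
  shows "norm (homogeneous_part a X k) \<le> row_norm X ^ k * L2_set (\<lambda>\<alpha>. cmod (a \<alpha>)) {\<alpha>. length \<alpha> = k}"
proof (rule norm_blinfun_bound)
  fix \<xi>
  let ?A = "L2_set (\<lambda>\<alpha>. cmod (a \<alpha>)) {\<alpha>. length \<alpha> = k}"
  define v where "v = blinfun_apply (homogeneous_part a X k) \<xi>"
  have "cinner v v = (\<Sum>\<alpha> | length \<alpha> = k. a \<alpha> * cinner \<xi> (word_adj X \<alpha> v))"
    by (subst v_def) (simp add: homogeneous_part_apply cinner_sum_left cinner_scaleC_left cinner_word_op[OF X])
  also have "cmod \<dots> \<le> (\<Sum>\<alpha> | length \<alpha> = k. norm \<xi> * (\<bar>cmod (a \<alpha>)\<bar> * \<bar>norm (word_adj X \<alpha> v)\<bar>))"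
  proof (intro sum_norm_le)
    fix \<alpha>
    show "cmod (a \<alpha> * cinner \<xi> (word_adj X \<alpha> v))
        \<le> norm \<xi> * (\<bar>cmod (a \<alpha>)\<bar> * \<bar>norm (word_adj X \<alpha> v)\<bar>)"
      using mult_left_mono[OF cmod_cinner_le[of \<xi> "word_adj X \<alpha> v"], of "cmod (a \<alpha>)"]
      by (simp add: norm_mult mult_ac)
  qed
  also have "\<dots> \<le> norm \<xi> * (?A * L2_set (\<lambda>\<alpha>. norm (word_adj X \<alpha> v)) {\<alpha>. length \<alpha> = k})"
    unfolding sum_distrib_left[symmetric] by (intro mult_left_mono L2_set_mult_ineq) auto
  also have "\<dots> \<le> norm \<xi> * (?A * (row_norm X ^ k * norm v))"
  proof (intro mult_left_mono)
    show "L2_set (\<lambda>\<alpha>. norm (word_adj X \<alpha> v)) {\<alpha>. length \<alpha> = k} \<le> row_norm X ^ k * norm v"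
      by (rule power2_le_imp_le) (auto simp: L2_set_power2 sum_word_adj_le[OF X] row_norm_nonneg)
  qed auto
  finally show "norm v \<le> row_norm X ^ k * ?A * norm \<xi>"
    by (intro norm_le_if_cinner_le) (auto simp: mult_ac row_norm_nonneg)
qed (simp add: row_norm_nonneg)

section \<open>The creation operators\<close>

lift_definition ket :: "'i \<Rightarrow> 'i ell2" is "\<lambda>w v. if v = w then 1 else 0"
  unfolding square_summable_def by (rule finite_nonzero_values_imp_summable_on) simp

lemma cinner_ket: "cinner x (ket w) = Rep_ell2 x w"
proof -
  have "(\<Sum>\<^sub>\<infinity>i. f i * cnj (if i = w then 1 else 0))
      = (\<Sum>\<^sub>\<infinity>i\<in>{w}. f i * cnj (if i = w then 1 else 0))" for f :: "'a \<Rightarrow> complex"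
    by (rule infsum_cong_neutral) auto
  thus ?thesis
    by (simp add: cinner_ell2.rep_eq ket.rep_eq)
qed

lemma cinner_ket_ket: "cinner (ket v) (ket w) = (if v = w then 1 else 0)"
  by (simp add: cinner_ket ket.rep_eq)

lemma norm_ket [simp]: "norm (ket w) = 1"
proof -
  have "(norm (ket w))\<^sup>2 = 1\<^sup>2"
    by (simp add: norm_sq_cinner cinner_ket_ket)
  thus ?thesis
    by (simp only: power2_eq_iff_nonneg norm_ge_zero zero_le_one)
qed

lemma creation_op_ket: "blinfun_apply (creation_op i) (ket w) = ket (i # w)"
  unfolding creation_op.rep_eq
  by transfer (auto simp: create_def fun_eq_iff split: list.splits)

lemma bounded_ops_creation_op: "creation_op i \<in> bounded_ops"
proof (rule bounded_opsI)
  show "blinfun_apply (creation_op i) (c *\<^sub>C x) = c *\<^sub>C blinfun_apply (creation_op i) x" for c x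
    unfolding creation_op.rep_eq
    by transfer (auto simp: create_def fun_eq_iff split: list.splits)
qed

lemma norm_creation_op: "norm (blinfun_apply (creation_op i) x) = norm x"
  unfolding creation_op.rep_eq by transfer (rule create_sum(2))

lemma creation_op_orthogonal:
  assumes "i \<noteq> j"
  shows "cinner (blinfun_apply (creation_op i) x) (blinfun_apply (creation_op j) y) = 0"
proof -
  have "create i f w * cnj (create j g w) = 0" for f g :: "'a list \<Rightarrow> complex" and w
    using assms by (auto simp: create_def split: list.splits)
  thus ?thesis
    unfolding creation_op.rep_eq cinner_ell2.rep_eq create_ell2.rep_eq by (simp only: infsum_0_simp)
qed

text \<open>The creation operators are isometries with orthogonal ranges.\<close>

lemma row_norm_creation_op: "row_norm (creation_op :: 'n :: finite \<Rightarrow> 'n fock op) \<le> 1"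
proof (rule row_norm_leI)
  fix \<xi> :: "'n \<Rightarrow> 'n fock" and \<eta>
  define v where "v = (\<Sum>i\<in>UNIV. blinfun_apply (creation_op i) (\<xi> i))"
  have "cinner v v = (\<Sum>i\<in>UNIV. \<Sum>j\<in>UNIV.
      cinner (blinfun_apply (creation_op i) (\<xi> i)) (blinfun_apply (creation_op j) (\<xi> j)))"
    unfolding v_def by (subst cinner_sum_left) (simp only: cinner_sum_right)
  also have "\<dots> = (\<Sum>i\<in>UNIV. \<Sum>j\<in>UNIV. if i = j then of_real ((norm (\<xi> i))\<^sup>2) else 0)"
    by (intro sum.cong refl) (auto simp: creation_op_orthogonal cinner_self norm_creation_op)
  finally have "(norm v)\<^sup>2 = (L2_set (\<lambda>i. norm (\<xi> i)) UNIV)\<^sup>2"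
    by (simp add: norm_sq_cinner[of v] L2_set_power2)
  hence "norm v = L2_set (\<lambda>i. norm (\<xi> i)) UNIV"
    by simp
  thus "cmod (\<Sum>i\<in>UNIV. cinner (blinfun_apply (creation_op i) (\<xi> i)) \<eta>)
      \<le> 1 * L2_set (\<lambda>i. norm (\<xi> i)) UNIV * norm \<eta>"
    using cmod_cinner_le[of v \<eta>] by (simp add: v_def cinner_sum_left)
qed (auto simp: bounded_ops_creation_op)

lemma word_op_ket: "blinfun_apply (word_op creation_op \<alpha>) (ket \<beta>) = ket (\<alpha> @ \<beta>)"
  by (induction \<alpha>) (auto simp: creation_op_ket)

section \<open>The von Neumann inequality for row contractions\<close>

text \<open>
  The adjoint of a polynomial in the creation operators maps a finitely supported sequence x to the
  sequence on the left; the inequality is the bound for this adjoint.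
\<close>

lemma adjoint_polynomial_bound:
  fixes c x :: "'n :: finite list \<Rightarrow> complex"
  assumes fin: "finite A" "finite B" "finite G"
    and G: "\<And>\<alpha> \<beta>. \<alpha> \<in> A \<Longrightarrow> \<beta> \<in> B \<Longrightarrow> \<alpha> @ \<beta> \<in> G"
  shows "(\<Sum>\<beta>\<in>B. (cmod (\<Sum>\<alpha>\<in>A. cnj (c \<alpha>) * x (\<alpha> @ \<beta>)))\<^sup>2)
    \<le> (norm (\<Sum>\<alpha>\<in>A. c \<alpha> *\<^sub>C word_op creation_op \<alpha>))\<^sup>2 * (\<Sum>\<gamma>\<in>G. (cmod (x \<gamma>))\<^sup>2)"
proof -
  define T where "T = (\<Sum>\<alpha>\<in>A. c \<alpha> *\<^sub>C word_op creation_op \<alpha>)"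
  define y where "y \<beta> = (\<Sum>\<alpha>\<in>A. cnj (c \<alpha>) * x (\<alpha> @ \<beta>))" for \<beta>
  define u where "u = (\<Sum>\<beta>\<in>B. y \<beta> *\<^sub>C ket \<beta>)"
  define v where "v = (\<Sum>\<gamma>\<in>G. x \<gamma> *\<^sub>C ket \<gamma>)"
  have u: "(norm u)\<^sup>2 = (\<Sum>\<beta>\<in>B. (cmod (y \<beta>))\<^sup>2)" and v: "(norm v)\<^sup>2 = (\<Sum>\<gamma>\<in>G. (cmod (x \<gamma>))\<^sup>2)"
    unfolding u_def v_def by (rule norm_orthonormal_sum; simp add: fin cinner_ket_ket)+
  have v_ket: "cinner v (ket \<gamma>) = x \<gamma>" if "\<gamma> \<in> G" for \<gamma>
  proof -
    have "cinner v (ket \<gamma>) = (\<Sum>\<delta>\<in>G. if \<delta> = \<gamma> then x \<delta> else 0)"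
      unfolding v_def cinner_sum_left cinner_scaleC_left cinner_ket_ket by (intro sum.cong) auto
    thus ?thesis
      using that fin by simp
  qed
  have word_u: "blinfun_apply (word_op creation_op \<alpha>) u = (\<Sum>\<beta>\<in>B. y \<beta> *\<^sub>C ket (\<alpha> @ \<beta>))" for \<alpha>
    unfolding u_def blinfun.sum_right
    by (simp add: bounded_ops_scaleC bounded_ops_word_op bounded_ops_creation_op word_op_ket)
  have "cinner v (blinfun_apply T u)
      = (\<Sum>\<alpha>\<in>A. \<Sum>\<beta>\<in>B. cnj (c \<alpha>) * (cnj (y \<beta>) * cinner v (ket (\<alpha> @ \<beta>))))"
    by (simp add: T_def blinfun.sum_left scaleC_blinfun.rep_eq word_u cinner_sum_right
        cinner_scaleC_right sum_distrib_left)
  also have "\<dots> = (\<Sum>\<beta>\<in>B. \<Sum>\<alpha>\<in>A. cnj (c \<alpha>) * (cnj (y \<beta>) * x (\<alpha> @ \<beta>)))"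
    by (subst sum.swap) (intro sum.cong refl, simp add: v_ket G)
  also have "\<dots> = (\<Sum>\<beta>\<in>B. y \<beta> * cnj (y \<beta>))"
  proof (intro sum.cong refl)
    have "(\<Sum>\<alpha>\<in>A. cnj (c \<alpha>) * (z * x (\<alpha> @ \<beta>))) = y \<beta> * z" for \<beta> z
      by (simp add: y_def sum_distrib_left mult_ac)
    thus "(\<Sum>\<alpha>\<in>A. cnj (c \<alpha>) * (cnj (y \<beta>) * x (\<alpha> @ \<beta>))) = y \<beta> * cnj (y \<beta>)" for \<beta> .
  qed
  also have "\<dots> = of_real ((norm u)\<^sup>2)"
    by (simp only: u complex_norm_square[symmetric] of_real_sum)
  finally have "(norm u)\<^sup>2 = cmod (cinner v (blinfun_apply T u))"
    by (simp add: norm_power)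
  also have "\<dots> \<le> norm v * norm (blinfun_apply T u)"
    by (rule cmod_cinner_le)
  also have "\<dots> \<le> norm v * (norm T * norm u)"
    by (intro mult_left_mono norm_blinfun) auto
  finally have "norm u * norm u \<le> norm u * (norm T * norm v)"
    by (simp add: power2_eq_square mult_ac)
  hence "norm u \<le> norm T * norm v"
    by (cases "norm u = 0") (auto simp: mult_le_cancel_left)
  hence "(norm u)\<^sup>2 \<le> (norm T)\<^sup>2 * (norm v)\<^sup>2"
    by (metis norm_ge_zero power_mono power_mult_distrib)
  thus ?thesis
    by (simp add: u v T_def y_def)
qed

definition defect :: "('n :: finite \<Rightarrow> 'h :: chilbert_space op) \<Rightarrow> 'h \<Rightarrow> 'h \<Rightarrow> complex" where
  "defect X x y = cinner x y - (\<Sum>i\<in>UNIV. cinner (blinfun_apply (adj (X i)) x) (blinfun_apply (adj (X i)) y))"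

lemma Re_defect_self:
  "Re (defect X x x) = (norm x)\<^sup>2 - (\<Sum>i\<in>UNIV. (norm (blinfun_apply (adj (X i)) x))\<^sup>2)"
  by (simp add: defect_def norm_sq_cinner)

lemma semi_inner_defect:
  fixes X :: "'n :: finite \<Rightarrow> 'h :: chilbert_space op"
  assumes X: "X \<in> row_cball"
  shows "semi_inner (defect X)"
proof
  have Xb: "\<And>i. X i \<in> bounded_ops"
    using X by (simp add: row_cball_def)
  fix x y z :: 'h and c
  show "defect X (x + y) z = defect X x z + defect X y z"
    by (simp add: defect_def cinner_add_left blinfun.add_right sum.distrib)
  show "defect X (c *\<^sub>C x) y = c * defect X x y"
    by (simp add: defect_def cinner_scaleC_left adj_scaleC[OF Xb] sum_distrib_left right_diff_distrib)
  show "defect X x y = cnj (defect X y x)"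
    by (simp add: defect_def flip: cinner_commute)
  have "L2_set (\<lambda>i. norm (blinfun_apply (adj (X i)) x)) UNIV \<le> row_norm X * norm x"
    by (rule L2_set_adj_le[OF Xb])
  also have "\<dots> \<le> 1 * norm x"
    using X by (intro mult_right_mono) (auto simp: row_cball_def)
  finally have "(L2_set (\<lambda>i. norm (blinfun_apply (adj (X i)) x)) UNIV)\<^sup>2 \<le> (norm x)\<^sup>2"
    by (intro power_mono) auto
  thus "0 \<le> Re (defect X x x)"
    unfolding Re_defect_self L2_set_power2 by simp
qed

text \<open>
  The sum telescopes. For a strict row contraction the right-hand side tends to |x|^2, which makes
  x \<mapsto> (X_\<beta>^* x) an isometry into the sequences with the norm of the defect form: this is the
  Poisson kernel.
\<close>

lemma sum_defect_words:
  fixes X :: "'n :: finite \<Rightarrow> 'h :: chilbert_space op"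
  shows "(\<Sum>\<beta> | length \<beta> < N. Re (defect X (word_adj X \<beta> x) (word_adj X \<beta> x)))
    = (norm x)\<^sup>2 - (\<Sum>\<beta> | length \<beta> = N. (norm (word_adj X \<beta> x))\<^sup>2)"
proof (induction N)
  case (Suc N)
  have "{\<beta> :: 'n list. length \<beta> < Suc N} = {\<beta>. length \<beta> < N} \<union> {\<beta>. length \<beta> = N}"
    by auto
  hence "(\<Sum>\<beta> | length \<beta> < Suc N. Re (defect X (word_adj X \<beta> x) (word_adj X \<beta> x)))
      = (\<Sum>\<beta> | length \<beta> < N. Re (defect X (word_adj X \<beta> x) (word_adj X \<beta> x)))
      + (\<Sum>\<beta> | length \<beta> = N. Re (defect X (word_adj X \<beta> x) (word_adj X \<beta> x)))"
    by (simp only:) (rule sum.union_disjoint; auto)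
  also have "(\<Sum>\<beta> | length \<beta> = N. Re (defect X (word_adj X \<beta> x) (word_adj X \<beta> x)))
      = (\<Sum>\<beta> | length \<beta> = N. (norm (word_adj X \<beta> x))\<^sup>2)
      - (\<Sum>\<beta> | length \<beta> = Suc N. (norm (word_adj X \<beta> x))\<^sup>2)"
    by (simp add: Re_defect_self sum_subtractf sum_words_Suc word_adj_append)
  finally show ?case
    by (simp only: Suc)
qed simp

text \<open>
  The Poisson kernel intertwines the adjoint of p(X) with the adjoint of p(S) applied to each
  coordinate in the defect space. Gram--Schmidt for the defect form reduces the finitely many vectors
  that occur in a truncation to finitely many scalar sequences.
\<close>

lemma von_Neumann_adjoint:
  fixes X :: "'n :: finite \<Rightarrow> 'h :: chilbert_space op"
  assumes X: "X \<in> row_ball" and A: "finite A"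
  shows "norm (\<Sum>\<alpha>\<in>A. cnj (c \<alpha>) *\<^sub>C word_adj X \<alpha> \<eta>)
    \<le> norm (\<Sum>\<alpha>\<in>A. c \<alpha> *\<^sub>C word_op creation_op \<alpha>) * norm \<eta>"
proof -
  have Xb: "\<And>i. X i \<in> bounded_ops" and \<rho>: "row_norm X < 1"
    using X by (auto simp: row_ball_def)
  interpret D: semi_inner "defect X"
    using X by (intro semi_inner_defect) (auto simp: row_ball_def row_cball_def)
  define P where "P = norm (\<Sum>\<alpha>\<in>A. c \<alpha> *\<^sub>C word_op creation_op \<alpha>)"
  define \<zeta> where "\<zeta> = (\<Sum>\<alpha>\<in>A. cnj (c \<alpha>) *\<^sub>C word_adj X \<alpha> \<eta>)"
  obtain d where d: "\<And>\<alpha>. \<alpha> \<in> A \<Longrightarrow> length \<alpha> < d"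
    using A finite_nat_set_iff_bounded[of "length ` A"] by blast
  have word_\<zeta>: "word_adj X \<beta> \<zeta> = (\<Sum>\<alpha>\<in>A. cnj (c \<alpha>) *\<^sub>C word_adj X (\<alpha> @ \<beta>) \<eta>)" for \<beta>
    by (simp add: \<zeta>_def word_adj_sum word_adj_scaleC[OF Xb] word_adj_append)
  \<comment> \<open>the truncated Poisson kernel of \<open>\<zeta>\<close>; the last term is the tail of the telescoping sum\<close>
  have step: "(norm \<zeta>)\<^sup>2 \<le> (P * norm \<eta>)\<^sup>2 + (row_norm X ^ N * norm \<zeta>)\<^sup>2" for N
  proof -
    let ?B = "{\<beta> :: 'n list. length \<beta> < N}" and ?G = "{\<gamma> :: 'n list. length \<gamma> < d + N}"
    obtain E where E: "D.orthonormal E"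
        "\<And>x. x \<in> (\<lambda>\<beta>. word_adj X \<beta> \<zeta>) ` ?B \<Longrightarrow> Re (defect X x x) = (\<Sum>e\<in>E. (cmod (defect X x e))\<^sup>2)"
      using D.Gram_Schmidt[of "(\<lambda>\<beta>. word_adj X \<beta> \<zeta>) ` ?B"] by auto
    have "(\<Sum>\<beta>\<in>?B. Re (defect X (word_adj X \<beta> \<zeta>) (word_adj X \<beta> \<zeta>)))
        = (\<Sum>\<beta>\<in>?B. \<Sum>e\<in>E. (cmod (defect X (word_adj X \<beta> \<zeta>) e))\<^sup>2)"
      using E(2) by (intro sum.cong) auto
    also have "\<dots> = (\<Sum>e\<in>E. \<Sum>\<beta>\<in>?B. (cmod (\<Sum>\<alpha>\<in>A. cnj (c \<alpha>) * defect X (word_adj X (\<alpha> @ \<beta>) \<eta>) e))\<^sup>2)"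
      by (subst sum.swap) (simp add: word_\<zeta> D.sum_left D.scaleC_left)
    also have "\<dots> \<le> (\<Sum>e\<in>E. P\<^sup>2 * (\<Sum>\<gamma>\<in>?G. (cmod (defect X (word_adj X \<gamma> \<eta>) e))\<^sup>2))"
      unfolding P_def using A d by (intro sum_mono adjoint_polynomial_bound) (auto intro: add_less_mono)
    also have "\<dots> = P\<^sup>2 * (\<Sum>\<gamma>\<in>?G. \<Sum>e\<in>E. (cmod (defect X (word_adj X \<gamma> \<eta>) e))\<^sup>2)"
      by (subst sum.swap) (simp add: sum_distrib_left)
    also have "\<dots> \<le> P\<^sup>2 * (\<Sum>\<gamma>\<in>?G. Re (defect X (word_adj X \<gamma> \<eta>) (word_adj X \<gamma> \<eta>)))"
      by (intro mult_left_mono sum_mono D.Bessel E(1)) auto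
    also have "\<dots> \<le> P\<^sup>2 * (norm \<eta>)\<^sup>2"
      unfolding sum_defect_words by (intro mult_left_mono) (auto simp: sum_nonneg)
    finally have "(norm \<zeta>)\<^sup>2 - (\<Sum>\<beta> | length \<beta> = N. (norm (word_adj X \<beta> \<zeta>))\<^sup>2) \<le> P\<^sup>2 * (norm \<eta>)\<^sup>2"
      unfolding sum_defect_words .
    thus ?thesis
      using sum_word_adj_le[of X, OF Xb, where k = N and y = \<zeta>] by (simp add: power_mult_distrib)
  qed
  have "(\<lambda>N. (P * norm \<eta>)\<^sup>2 + (row_norm X ^ N * norm \<zeta>)\<^sup>2) \<longlonglongrightarrow> (P * norm \<eta>)\<^sup>2 + (0 * norm \<zeta>)\<^sup>2"
    using \<rho> row_norm_nonneg[of X] by (intro tendsto_intros LIMSEQ_power_zero) auto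
  hence "(norm \<zeta>)\<^sup>2 \<le> (P * norm \<eta>)\<^sup>2 + (0 * norm \<zeta>)\<^sup>2"
    by (rule LIMSEQ_le_const) (use step in auto)
  hence "norm \<zeta> \<le> P * norm \<eta>"
    by (intro power2_le_imp_le[of "norm \<zeta>"]) (auto simp: P_def)
  thus ?thesis
    by (simp add: \<zeta>_def P_def)
qed

lemma von_Neumann_row_ball:
  fixes X :: "'n :: finite \<Rightarrow> 'h :: chilbert_space op"
  assumes X: "X \<in> row_ball" and A: "finite A"
  shows "norm (\<Sum>\<alpha>\<in>A. c \<alpha> *\<^sub>C word_op X \<alpha>) \<le> norm (\<Sum>\<alpha>\<in>A. c \<alpha> *\<^sub>C word_op creation_op \<alpha>)"
proof (rule norm_blinfun_bound)
  fix \<xi>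
  define P where "P = norm (\<Sum>\<alpha>\<in>A. c \<alpha> *\<^sub>C word_op (creation_op :: 'n \<Rightarrow> _) \<alpha>)"
  define v where "v = blinfun_apply (\<Sum>\<alpha>\<in>A. c \<alpha> *\<^sub>C word_op X \<alpha>) \<xi>"
  have Xb: "\<And>i. X i \<in> bounded_ops"
    using X by (auto simp: row_ball_def)
  have "cinner v v = cinner \<xi> (\<Sum>\<alpha>\<in>A. cnj (c \<alpha>) *\<^sub>C word_adj X \<alpha> v)"
    by (subst v_def) (simp add: blinfun.sum_left scaleC_blinfun.rep_eq cinner_sum_left
        cinner_scaleC_left cinner_word_op[OF Xb] cinner_sum_right cinner_scaleC_right)
  also have "cmod \<dots> \<le> norm \<xi> * norm (\<Sum>\<alpha>\<in>A. cnj (c \<alpha>) *\<^sub>C word_adj X \<alpha> v)"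
    by (rule cmod_cinner_le)
  also have "\<dots> \<le> norm \<xi> * (P * norm v)"
    unfolding P_def by (intro mult_left_mono von_Neumann_adjoint X A) auto
  finally show "norm v \<le> P * norm \<xi>"
    by (intro norm_le_if_cinner_le) (auto simp: P_def mult_ac)
qed simp

section \<open>Free power series with bounded homogeneous parts\<close>

text \<open>Operator-valued series are summed in the Banach space of bounded operators.\<close>

instance chilbert_space \<subseteq> banach ..

lemma free_expansion_free_eval:
  "has_free_expansion f a \<Longrightarrow> X \<in> row_ball \<Longrightarrow> f X = free_eval a X"
  unfolding has_free_expansion_def free_eval_def by (metis sums_unique)

lemma homogeneous_part_diff:
  "homogeneous_part (\<lambda>\<alpha>. a \<alpha> - c \<alpha>) X k = homogeneous_part a X k - homogeneous_part c X k"
  by (simp add: homogeneous_part_def complex_vector.scale_left_diff_distrib sum_subtractf)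

lemma free_eval_diff:
  assumes "summable (homogeneous_part a X)" "summable (homogeneous_part c X)"
  shows "free_eval (\<lambda>\<alpha>. a \<alpha> - c \<alpha>) X = free_eval a X - free_eval c X"
  unfolding free_eval_def homogeneous_part_diff by (rule suminf_diff[OF assms, symmetric])

lemma free_eval_bounded_coefficients:
  fixes X :: "'n :: finite \<Rightarrow> 'h :: chilbert_space op"
  assumes X: "X \<in> row_ball" and K: "\<And>k. L2_set (\<lambda>\<alpha>. cmod (a \<alpha>)) {\<alpha>. length \<alpha> = k} \<le> K"
  shows "summable (homogeneous_part a X)" "norm (free_eval a X) \<le> K / (1 - row_norm X)"
proof -
  have \<rho>: "0 \<le> row_norm X" "row_norm X < 1" and Xb: "\<And>i. X i \<in> bounded_ops"
    using X by (auto simp: row_ball_def row_norm_nonneg)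
  have le: "norm (homogeneous_part a X k) \<le> row_norm X ^ k * K" for k
  proof -
    have "norm (homogeneous_part a X k) \<le> row_norm X ^ k * L2_set (\<lambda>\<alpha>. cmod (a \<alpha>)) {\<alpha>. length \<alpha> = k}"
      by (rule norm_homogeneous_part_row_le[OF Xb])
    also have "\<dots> \<le> row_norm X ^ k * K"
      using \<rho> by (intro mult_left_mono K) auto
    finally show ?thesis .
  qed
  have geom: "(\<lambda>k. row_norm X ^ k * K) sums (1 / (1 - row_norm X) * K)"
    using \<rho> by (intro sums_mult2 geometric_sums) auto
  show "summable (homogeneous_part a X)"
    by (rule summable_comparison_test'[OF sums_summable[OF geom]]) (rule le)
  have "norm (free_eval a X) \<le> (\<Sum>k. row_norm X ^ k * K)"
    unfolding free_eval_def by (rule norm_suminf_le[OF le sums_summable[OF geom]])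
  thus "norm (free_eval a X) \<le> K / (1 - row_norm X)"
    by (simp flip: sums_unique[OF geom])
qed

lemma free_eval_finite_support:
  fixes X :: "'n :: finite \<Rightarrow> 'h :: chilbert_space op"
  assumes A: "finite A" and c: "{\<alpha>. c \<alpha> \<noteq> 0} \<subseteq> A"
  shows "summable (homogeneous_part c X)" "free_eval c X = (\<Sum>\<alpha>\<in>A. c \<alpha> *\<^sub>C word_op X \<alpha>)"
proof -
  obtain d where d: "\<And>\<alpha>. \<alpha> \<in> A \<Longrightarrow> length \<alpha> < d"
    using A finite_nat_set_iff_bounded[of "length ` A"] by blast
  have zero: "homogeneous_part c X k = 0" if "k \<notin> {..<d}" for k
    unfolding homogeneous_part_def using that c d by (intro sum.neutral) force
  show "summable (homogeneous_part c X)"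
    by (rule summable_finite[OF finite_lessThan zero])
  have "free_eval c X = (\<Sum>k<d. homogeneous_part c X k)"
    unfolding free_eval_def by (rule suminf_finite[OF finite_lessThan zero])
  also have "\<dots> = (\<Sum>k<d. \<Sum>\<alpha> | \<alpha> \<in> {\<alpha>. length \<alpha> < d} \<and> length \<alpha> = k. c \<alpha> *\<^sub>C word_op X \<alpha>)"
    unfolding homogeneous_part_def by (intro sum.cong) auto
  also have "\<dots> = (\<Sum>\<alpha> | length \<alpha> < d. c \<alpha> *\<^sub>C word_op X \<alpha>)"
    by (rule sum.group) auto
  also have "\<dots> = (\<Sum>\<alpha>\<in>A. c \<alpha> *\<^sub>C word_op X \<alpha>)"
    by (rule sum.mono_neutral_right) (use d c in auto)
  finally show "free_eval c X = (\<Sum>\<alpha>\<in>A. c \<alpha> *\<^sub>C word_op X \<alpha>)" .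
qed

lemma von_Neumann_polynomial_diff:
  fixes X :: "'n :: finite \<Rightarrow> 'h :: chilbert_space op"
  assumes X: "X \<in> row_ball" and fin: "finite {\<alpha>. c \<alpha> \<noteq> 0}" "finite {\<alpha>. c' \<alpha> \<noteq> 0}"
  shows "norm (free_eval c X - free_eval c' X)
    \<le> norm (free_eval c creation_op - free_eval c' (creation_op :: 'n \<Rightarrow> 'n fock op))"
proof -
  define A where "A = {\<alpha>. c \<alpha> \<noteq> 0} \<union> {\<alpha>. c' \<alpha> \<noteq> 0}"
  have A: "finite A" and c: "{\<alpha>. c \<alpha> \<noteq> 0} \<subseteq> A" and c': "{\<alpha>. c' \<alpha> \<noteq> 0} \<subseteq> A"
    using fin by (auto simp: A_def)
  show ?thesis
    unfolding free_eval_finite_support(2)[OF A c] free_eval_finite_support(2)[OF A c']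
      sum_subtractf[symmetric] complex_vector.scale_left_diff_distrib[symmetric]
    by (rule von_Neumann_row_ball[OF X A])
qed

section \<open>The boundary function determines the coefficients\<close>

lemma creation_op_row_cball: "(creation_op :: 'n :: finite \<Rightarrow> 'n fock op) \<in> row_cball"
  by (simp add: row_cball_def bounded_ops_creation_op row_norm_creation_op)

lemma scaleR_row_ball:
  fixes X :: "'n :: finite \<Rightarrow> 'h :: chilbert_space op"
  shows "X \<in> row_cball \<Longrightarrow> \<bar>r\<bar> < 1 \<Longrightarrow> (\<lambda>i. r *\<^sub>R X i) \<in> row_ball"
  using scaleC_row_ball[of X "of_real r"] by (simp add: scaleC_of_real)

lemma homogeneous_part_creation_ket:
  "cinner (blinfun_apply (homogeneous_part a creation_op k) (ket [])) (ket \<alpha>)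
    = (if k = length \<alpha> then a \<alpha> else 0)"
proof -
  have "cinner (blinfun_apply (homogeneous_part a creation_op k) (ket [])) (ket \<alpha>)
      = (\<Sum>\<beta> | length \<beta> = k. if \<beta> = \<alpha> then a \<beta> else 0)"
    unfolding homogeneous_part_apply cinner_sum_left cinner_scaleC_left word_op_ket cinner_ket_ket
    by (intro sum.cong) auto
  thus ?thesis
    by auto
qed

lemma free_eval_creation_ket:
  fixes a :: "'n :: finite list \<Rightarrow> complex"
  assumes "summable (homogeneous_part a (\<lambda>i. r *\<^sub>R creation_op i))"
  shows "cinner (blinfun_apply (free_eval a (\<lambda>i. r *\<^sub>R creation_op i)) (ket [])) (ket \<alpha>)
    = of_real r ^ length \<alpha> * a \<alpha>"
proof -
  have "bounded_linear (\<lambda>T :: 'n fock op. cinner (blinfun_apply T (ket [])) (ket \<alpha>))"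
    by (rule bounded_linear_compose[OF bounded_linear_cinner_left blinfun.bounded_linear_left])
  from bounded_linear.sums[OF this summable_sums[OF assms]]
  have "(\<lambda>k. cinner (blinfun_apply (homogeneous_part a (\<lambda>i. r *\<^sub>R creation_op i) k) (ket [])) (ket \<alpha>))
      sums cinner (blinfun_apply (free_eval a (\<lambda>i. r *\<^sub>R creation_op i)) (ket [])) (ket \<alpha>)"
    by (simp add: free_eval_def)
  moreover have "cinner (blinfun_apply (homogeneous_part a (\<lambda>i. r *\<^sub>R creation_op i) k) (ket [])) (ket \<alpha>)
      = (if k = length \<alpha> then of_real r ^ length \<alpha> * a \<alpha> else 0)" for k
    unfolding scaleC_of_real[symmetric] homogeneous_part_scaleC[of creation_op, OF bounded_ops_creation_op]
      scaleC_blinfun.rep_eq cinner_scaleC_left homogeneous_part_creation_ket by simp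
  ultimately have "(\<lambda>k. if k = length \<alpha> then of_real r ^ length \<alpha> * a \<alpha> else 0)
      sums cinner (blinfun_apply (free_eval a (\<lambda>i. r *\<^sub>R creation_op i)) (ket [])) (ket \<alpha>)"
    by simp
  thus ?thesis
    using sums_single[of "length \<alpha>" "\<lambda>_. of_real r ^ length \<alpha> * a \<alpha>"] sums_unique2 by blast
qed

lemma eventually_at_left_1: "\<forall>\<^sub>F r in at_left (1 :: real). 0 < r \<and> r < 1"
  using eventually_at_left_real[of 0 1] by simp

text \<open>
  By the bound on the coefficients the series at r S converges in norm, so that its sum has the
  Fourier coefficients r^|\<alpha>| a_\<alpha>, and r tends to 1.
\<close>

lemma boundary_function_coefficient:
  fixes a :: "'n :: finite list \<Rightarrow> complex"
  assumes a: "\<And>k. (\<Sum>\<alpha> | length \<alpha> = k. (cmod (a \<alpha>))\<^sup>2) \<le> 1"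
    and lim: "((\<lambda>r. blinfun_apply (free_eval a (\<lambda>i. r *\<^sub>R creation_op i)) (ket []))
      \<longlongrightarrow> blinfun_apply T (ket [])) (at_left 1)"
  shows "cinner (blinfun_apply T (ket [])) (ket \<alpha>) = a \<alpha>"
proof (rule tendsto_unique)
  show "((\<lambda>r. cinner (blinfun_apply (free_eval a (\<lambda>i. r *\<^sub>R creation_op i)) (ket [])) (ket \<alpha>))
      \<longlongrightarrow> cinner (blinfun_apply T (ket [])) (ket \<alpha>)) (at_left 1)"
    by (rule bounded_linear.tendsto[OF bounded_linear_cinner_left lim])
  have "((\<lambda>r. of_real r ^ length \<alpha> * a \<alpha>) \<longlongrightarrow> of_real 1 ^ length \<alpha> * a \<alpha>) (at_left (1 :: real))"
    by (intro tendsto_intros)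
  hence "((\<lambda>r. of_real r ^ length \<alpha> * a \<alpha>) \<longlongrightarrow> a \<alpha>) (at_left (1 :: real))"
    by simp
  moreover have "\<forall>\<^sub>F r in at_left 1. of_real r ^ length \<alpha> * a \<alpha>
      = cinner (blinfun_apply (free_eval a (\<lambda>i. r *\<^sub>R creation_op i)) (ket [])) (ket \<alpha>)"
    using eventually_at_left_1
  proof eventually_elim
    case (elim r)
    have "L2_set (\<lambda>\<alpha>. cmod (a \<alpha>)) {\<alpha>. length \<alpha> = k} \<le> 1" for k
      using a[of k] by (simp add: L2_set_def)
    hence "summable (homogeneous_part a (\<lambda>i. r *\<^sub>R creation_op i))"
      using elim by (intro free_eval_bounded_coefficients(1) scaleR_row_ball creation_op_row_cball) auto
    thus ?case
      by (simp add: free_eval_creation_ket)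
  qed
  ultimately show "((\<lambda>r. cinner (blinfun_apply (free_eval a (\<lambda>i. r *\<^sub>R creation_op i)) (ket [])) (ket \<alpha>))
      \<longlongrightarrow> a \<alpha>) (at_left 1)"
    using tendsto_cong by fastforce
qed simp

section \<open>Polynomials are dense in the noncommutative disc algebra\<close>

lemma bounded_linear_scaleC_blinfun:
  "bounded_linear (\<lambda>T :: 'a :: real_normed_vector \<Rightarrow>\<^sub>L 'h :: chilbert_space. c *\<^sub>C T)"
proof (rule bounded_linear_intro[where K = "cmod c"])
  fix T U :: "'a \<Rightarrow>\<^sub>L 'h" and r :: real
  show "c *\<^sub>C (T + U) = c *\<^sub>C T + c *\<^sub>C U"
    by (rule scaleC_add_right)
  show "c *\<^sub>C (r *\<^sub>R T) = r *\<^sub>R (c *\<^sub>C T)"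
    by (simp add: scaleC_scaleC mult.commute flip: scaleC_of_real)
  show "norm (c *\<^sub>C T) \<le> norm T * cmod c"
  proof (rule norm_blinfun_bound)
    show "norm (blinfun_apply (c *\<^sub>C T) x) \<le> norm T * cmod c * norm x" for x
      using mult_left_mono[OF norm_blinfun[of T x], of "cmod c"]
      by (simp add: scaleC_blinfun.rep_eq norm_scaleC mult_ac)
  qed simp
qed

lemma word_op_append: "word_op X (\<alpha> @ \<beta>) = word_op X \<alpha> o\<^sub>L word_op X \<beta>"
  by (induction \<alpha>) (auto intro: blinfun_eqI)

lemma span_words_compose:
  fixes X :: "'n \<Rightarrow> 'h :: chilbert_space op"
  assumes X: "\<And>i. X i \<in> bounded_ops"
    and U: "U \<in> complex_vector.span (range (word_op X))"
    and V: "V \<in> complex_vector.span (range (word_op X))"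
  shows "U o\<^sub>L V \<in> complex_vector.span (range (word_op X))" (is "_ \<in> ?S")
proof -
  note add = bounded_bilinear.add_left[OF bounded_bilinear_blinfun_compose]
    bounded_bilinear.add_right[OF bounded_bilinear_blinfun_compose]
  note zero = bounded_bilinear.zero_left[OF bounded_bilinear_blinfun_compose]
    bounded_bilinear.zero_right[OF bounded_bilinear_blinfun_compose]
  have left: "word_op X \<alpha> o\<^sub>L V \<in> ?S" for \<alpha>
    using V
  proof (induction V rule: complex_vector.span_induct)
    case (step V)
    thus ?case
      by (auto simp flip: word_op_append intro: complex_vector.span_base)
  next
    case base
    have "word_op X \<alpha> o\<^sub>L c *\<^sub>C V = c *\<^sub>C (word_op X \<alpha> o\<^sub>L V)" for c and V :: "'h op"
      by (rule blinfun_eqI)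
        (simp add: scaleC_blinfun.rep_eq bounded_ops_scaleC[OF bounded_ops_word_op[of X, OF X]])
    thus ?case
      by (auto simp: complex_vector.subspace_def add zero
          intro: complex_vector.span_add complex_vector.span_scale complex_vector.span_zero)
  qed
  show ?thesis
    using U
  proof (induction U rule: complex_vector.span_induct)
    case (step U)
    thus ?case
      using left by auto
  next
    case base
    have "c *\<^sub>C U o\<^sub>L V = c *\<^sub>C (U o\<^sub>L V)" for c and U :: "'h op"
      by (rule blinfun_eqI) (simp add: scaleC_blinfun.rep_eq)
    thus ?case
      by (auto simp: complex_vector.subspace_def add zero
          intro: complex_vector.span_add complex_vector.span_scale complex_vector.span_zero)
  qed
qed

lemma is_op_algebra_closure_span_words:
  fixes X :: "'n \<Rightarrow> 'h :: chilbert_space op"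
  assumes X: "\<And>i. X i \<in> bounded_ops"
  shows "is_op_algebra (closure (complex_vector.span (range (word_op X))))" (is "is_op_algebra (closure ?S)")
  unfolding is_op_algebra_def complex_vector.subspace_def
proof (intro conjI ballI allI)
  show "0 \<in> closure ?S"
    using complex_vector.span_zero closure_subset by blast
next
  fix U V assume "U \<in> closure ?S" "V \<in> closure ?S"
  then obtain u v where u: "\<And>n. u n \<in> ?S" "u \<longlonglongrightarrow> U" and v: "\<And>n. v n \<in> ?S" "v \<longlonglongrightarrow> V"
    unfolding closure_sequential by blast
  have "(\<lambda>n. u n + v n) \<longlonglongrightarrow> U + V"
    by (intro tendsto_intros u v)
  thus "U + V \<in> closure ?S"
    unfolding closure_sequential
    by (intro exI[of _ "\<lambda>n. u n + v n"]) (simp add: complex_vector.span_add u v)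
  have "(\<lambda>n. u n o\<^sub>L v n) \<longlonglongrightarrow> (U o\<^sub>L V)"
    by (rule bounded_bilinear.tendsto[OF bounded_bilinear_blinfun_compose u(2) v(2)])
  thus "U o\<^sub>L V \<in> closure ?S"
    unfolding closure_sequential
    by (intro exI[of _ "\<lambda>n. u n o\<^sub>L v n"]) (simp add: span_words_compose X u v)
next
  fix c U assume "U \<in> closure ?S"
  then obtain u where u: "\<And>n. u n \<in> ?S" "u \<longlonglongrightarrow> U"
    unfolding closure_sequential by blast
  have "(\<lambda>n. c *\<^sub>C u n) \<longlonglongrightarrow> c *\<^sub>C U"
    by (rule bounded_linear.tendsto[OF bounded_linear_scaleC_blinfun u(2)])
  thus "c *\<^sub>C U \<in> closure ?S"
    unfolding closure_sequential
    by (intro exI[of _ "\<lambda>n. c *\<^sub>C u n"]) (simp add: complex_vector.span_scale u)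
qed

lemma nc_disc_algebra_subset_closure:
  "nc_disc_algebra \<subseteq> closure (complex_vector.span (range (word_op (creation_op :: 'n :: finite \<Rightarrow> 'n fock op))))"
  (is "_ \<subseteq> closure ?S")
proof -
  have words: "word_op creation_op \<alpha> \<in> closure ?S" for \<alpha>
    by (rule subsetD[OF closure_subset complex_vector.span_base]) simp
  have "id_blinfun \<in> closure ?S"
    using words[of "[]"] by simp
  moreover have "creation_op i \<in> closure ?S" for i
  proof -
    have "word_op creation_op [i] = creation_op i"
      by (rule blinfun_eqI) simp
    thus ?thesis
      using words[of "[i]"] by simp
  qed
  moreover have "is_op_algebra (closure ?S)"
    by (rule is_op_algebra_closure_span_words) (rule bounded_ops_creation_op)
  ultimately show ?thesis
    unfolding nc_disc_algebra_def by (intro Inter_lower) auto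
qed

lemma inj_word_op_creation: "inj (word_op (creation_op :: 'n \<Rightarrow> 'n fock op))"
proof (rule injI)
  fix \<alpha> \<beta> :: "'n list"
  assume "word_op (creation_op :: 'n \<Rightarrow> 'n fock op) \<alpha> = word_op creation_op \<beta>"
  hence "ket (\<alpha> @ []) = ket (\<beta> @ [])"
    by (metis word_op_ket)
  thus "\<alpha> = \<beta>"
    by (metis append_Nil2 cinner_ket_ket zero_neq_one)
qed

lemma span_words_free_eval:
  assumes "T \<in> complex_vector.span (range (word_op (creation_op :: 'n :: finite \<Rightarrow> 'n fock op)))"
  shows "\<exists>c. finite {\<alpha>. c \<alpha> \<noteq> 0} \<and> T = free_eval c creation_op"
proof -
  obtain t s where t: "finite t" "t \<subseteq> range (word_op (creation_op :: 'n \<Rightarrow> 'n fock op))"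
      "T = (\<Sum>V\<in>t. s V *\<^sub>C V)"
    using assms unfolding complex_vector.span_explicit by blast
  obtain A where A: "finite A" "t = word_op creation_op ` A"
    using finite_subset_image[OF t(1,2)] by blast
  define c where "c \<alpha> = (if \<alpha> \<in> A then s (word_op creation_op \<alpha>) else 0)" for \<alpha>
  have "T = (\<Sum>\<alpha>\<in>A. s (word_op creation_op \<alpha>) *\<^sub>C word_op creation_op \<alpha>)"
    unfolding t(3) A(2) by (subst sum.reindex) (auto intro: inj_on_subset[OF inj_word_op_creation])
  also have "\<dots> = (\<Sum>\<alpha>\<in>A. c \<alpha> *\<^sub>C word_op creation_op \<alpha>)"
    by (intro sum.cong) (auto simp: c_def)
  also have "\<dots> = free_eval c creation_op"
    by (rule free_eval_finite_support(2)[symmetric]) (auto simp: A c_def)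
  finally show ?thesis
    by (intro exI[of _ c] conjI finite_subset[OF _ A(1)]) (auto simp: c_def)
qed

section \<open>Radial limits\<close>

lemma tendsto_polynomial_radial:
  fixes X :: "'n :: finite \<Rightarrow> 'h :: chilbert_space op"
  assumes X: "\<And>i. X i \<in> bounded_ops" and c: "finite {\<alpha>. c \<alpha> \<noteq> 0}"
  shows "((\<lambda>r. free_eval c (\<lambda>i. r *\<^sub>R X i)) \<longlongrightarrow> free_eval c X) (at_left 1)"
proof -
  have "word_op (\<lambda>i. r *\<^sub>R X i) \<alpha> = r ^ length \<alpha> *\<^sub>R word_op X \<alpha>" for r \<alpha>
    using word_op_scaleC[of X "of_real r"] X by (simp add: scaleC_of_real flip: of_real_power)
  moreover have "((\<lambda>r. \<Sum>\<alpha> | c \<alpha> \<noteq> 0. c \<alpha> *\<^sub>C (r ^ length \<alpha> *\<^sub>R word_op X \<alpha>))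
      \<longlongrightarrow> (\<Sum>\<alpha> | c \<alpha> \<noteq> 0. c \<alpha> *\<^sub>C (1 ^ length \<alpha> *\<^sub>R word_op X \<alpha>))) (at_left 1)"
    by (intro tendsto_intros bounded_linear.tendsto[OF bounded_linear_scaleC_blinfun])
  moreover have "free_eval c Z = (\<Sum>\<alpha> | c \<alpha> \<noteq> 0. c \<alpha> *\<^sub>C word_op Z \<alpha>)" for Z :: "'n \<Rightarrow> 'h op"
    by (rule free_eval_finite_support(2)[OF c order_refl])
  ultimately show ?thesis
    by simp
qed

text \<open>
  Polynomials p_n with p_n(S) \<longlonglongrightarrow> T have p_n(rX) \<longlonglongrightarrow> f(rX), uniformly in r < 1 by the von Neumann
  inequality, and each r \<mapsto> p_n(rX) is continuous up to r = 1. The limits may be interchanged.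
\<close>

lemma radial_limit_exists:
  fixes X :: "'n :: finite \<Rightarrow> 'h :: chilbert_space op" and T :: "'n fock op"
  assumes X: "X \<in> row_cball"
    and T: "T \<in> closure (complex_vector.span (range (word_op creation_op)))"
    and coeff: "\<And>\<alpha>. cinner (blinfun_apply T (ket [])) (ket \<alpha>) = a \<alpha>"
  shows "\<exists>Y. ((\<lambda>r. free_eval a (\<lambda>i. r *\<^sub>R X i)) \<longlongrightarrow> Y) (at_left 1)"
proof -
  have Xb: "\<And>i. X i \<in> bounded_ops"
    using X by (simp add: row_cball_def)
  obtain p where p: "\<And>n. p n \<in> complex_vector.span (range (word_op creation_op))" "p \<longlonglongrightarrow> T"
    using T unfolding closure_sequential by blast
  obtain c where fin: "\<And>n. finite {\<alpha>. c n \<alpha> \<noteq> 0}" and p_eq: "\<And>n. p n = free_eval (c n) creation_op"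
    using span_words_free_eval[OF p(1)] by metis
  have ball: "(\<lambda>i. r *\<^sub>R X i) \<in> row_ball" if "0 < r \<and> r < 1" for r
    using that by (intro scaleR_row_ball X) auto
  have diff_le: "norm (free_eval (c m) (\<lambda>i. r *\<^sub>R X i) - free_eval (c n) (\<lambda>i. r *\<^sub>R X i)) \<le> norm (p m - p n)"
    if "0 < r \<and> r < 1" for r m n
    unfolding p_eq by (rule von_Neumann_polynomial_diff[OF ball[OF that] fin fin])
  have coeff_p: "cinner (blinfun_apply (p n) (ket [])) (ket \<alpha>) = c n \<alpha>" for n \<alpha>
    using free_eval_creation_ket[of "c n" 1 \<alpha>]
      free_eval_finite_support(1)[OF fin order_refl, of n creation_op]
    by (simp add: p_eq)
  have coeff_le: "L2_set (\<lambda>\<alpha>. cmod (c n \<alpha> - a \<alpha>)) {\<alpha>. length \<alpha> = k} \<le> norm (p n - T)" for n k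
  proof -
    have "(L2_set (\<lambda>\<alpha>. cmod (c n \<alpha> - a \<alpha>)) {\<alpha>. length \<alpha> = k})\<^sup>2
        = (\<Sum>\<alpha> | length \<alpha> = k. (cmod (cinner (blinfun_apply (p n - T) (ket [])) (ket \<alpha>)))\<^sup>2)"
      by (simp add: L2_set_power2 blinfun.diff_left cinner_diff_left coeff coeff_p)
    also have "\<dots> \<le> (norm (blinfun_apply (p n - T) (ket [])))\<^sup>2"
      by (rule Bessel_family) (auto simp: cinner_ket_ket)
    finally have "L2_set (\<lambda>\<alpha>. cmod (c n \<alpha> - a \<alpha>)) {\<alpha>. length \<alpha> = k} \<le> norm (blinfun_apply (p n - T) (ket []))"
      by (rule power2_le_imp_le) simp
    thus ?thesis
      using norm_blinfun[of "p n - T" "ket []"] by simp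
  qed
  have diff_T: "norm (free_eval (c m) (\<lambda>i. r *\<^sub>R X i) - free_eval a (\<lambda>i. r *\<^sub>R X i)) \<le> norm (p m - T)"
    if r: "0 < r \<and> r < 1" for r m
  proof -
    let ?Z = "\<lambda>i. r *\<^sub>R X i"
    have sum_c: "summable (homogeneous_part (c n) ?Z)" for n
      by (rule free_eval_finite_support(1)[OF fin order_refl])
    have "summable (homogeneous_part (\<lambda>\<alpha>. c 0 \<alpha> - a \<alpha>) ?Z)"
      by (rule free_eval_bounded_coefficients(1)[OF ball[OF r] coeff_le])
    from summable_diff[OF sum_c[of 0] this] have sum_a: "summable (homogeneous_part a ?Z)"
      unfolding homogeneous_part_diff by simp
    have le: "norm (free_eval (c n) ?Z - free_eval a ?Z) \<le> norm (p n - T) / (1 - row_norm ?Z)" for n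
      using free_eval_bounded_coefficients(2)[OF ball[OF r] coeff_le, of n]
      unfolding free_eval_diff[OF sum_c sum_a] .
    have "(\<lambda>n. norm (p n - T) / (1 - row_norm ?Z)) \<longlonglongrightarrow> norm (T - T) / (1 - row_norm ?Z)"
      using ball[OF r] by (intro tendsto_intros p) (auto simp: row_ball_def)
    hence "(\<lambda>n. norm (p n - T) / (1 - row_norm ?Z)) \<longlonglongrightarrow> 0"
      by simp
    hence "(\<lambda>n. free_eval (c n) ?Z - free_eval a ?Z) \<longlonglongrightarrow> 0"
      by (rule Lim_null_comparison[rotated]) (intro always_eventually allI le)
    hence lim: "(\<lambda>n. free_eval (c n) ?Z) \<longlonglongrightarrow> free_eval a ?Z"
      by (simp add: LIM_zero_iff)
    show ?thesis
    proof (rule LIMSEQ_le)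
      show "(\<lambda>n. norm (free_eval (c m) ?Z - free_eval (c n) ?Z)) \<longlonglongrightarrow> norm (free_eval (c m) ?Z - free_eval a ?Z)"
        by (intro tendsto_intros lim)
      show "(\<lambda>n. norm (p m - p n)) \<longlonglongrightarrow> norm (p m - T)"
        by (intro tendsto_intros p)
    qed (use diff_le[OF r] in auto)
  qed
  have "norm (free_eval (c m) X - free_eval (c n) X) \<le> norm (p m - p n)" for m n
  proof (rule tendsto_upperbound)
    show "((\<lambda>r. norm (free_eval (c m) (\<lambda>i. r *\<^sub>R X i) - free_eval (c n) (\<lambda>i. r *\<^sub>R X i)))
        \<longlongrightarrow> norm (free_eval (c m) X - free_eval (c n) X)) (at_left 1)"
      by (intro tendsto_intros tendsto_polynomial_radial Xb fin)
    show "\<forall>\<^sub>F r in at_left 1. norm (free_eval (c m) (\<lambda>i. r *\<^sub>R X i) - free_eval (c n) (\<lambda>i. r *\<^sub>R X i))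
        \<le> norm (p m - p n)"
      using eventually_at_left_1 by eventually_elim (rule diff_le)
  qed simp
  hence "Cauchy (\<lambda>n. free_eval (c n) X)"
    using LIMSEQ_imp_Cauchy[OF p(2)] unfolding Cauchy_def dist_norm by (meson le_less_trans)
  then obtain Y where Y: "(\<lambda>n. free_eval (c n) X) \<longlonglongrightarrow> Y"
    using Cauchy_convergent convergent_def by blast
  have "((\<lambda>r. free_eval a (\<lambda>i. r *\<^sub>R X i)) \<longlongrightarrow> Y) (at_left 1)"
  proof (rule swap_uniform_limit')
    show "\<forall>\<^sub>F n in sequentially.
        ((\<lambda>r. free_eval (c n) (\<lambda>i. r *\<^sub>R X i)) \<longlongrightarrow> free_eval (c n) X) (at_left 1)"
      by (intro always_eventually allI tendsto_polynomial_radial Xb fin)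
    show "uniform_limit {0<..<1} (\<lambda>n r. free_eval (c n) (\<lambda>i. r *\<^sub>R X i))
        (\<lambda>r. free_eval a (\<lambda>i. r *\<^sub>R X i)) sequentially"
    proof (rule uniform_limitI)
      fix e :: real assume "e > 0"
      have "\<forall>\<^sub>F n in sequentially. dist (p n) T < e"
        by (rule tendstoD[OF p(2) \<open>e > 0\<close>])
      thus "\<forall>\<^sub>F n in sequentially. \<forall>r\<in>{0<..<1}.
          dist (free_eval (c n) (\<lambda>i. r *\<^sub>R X i)) (free_eval a (\<lambda>i. r *\<^sub>R X i)) < e"
        by eventually_elim (auto simp: dist_norm intro: le_less_trans[OF diff_T])
    qed
    show "\<forall>\<^sub>F r in at_left 1. r \<in> {0<..<1 :: real}"
      using eventually_at_left_1 by eventually_elim auto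
  qed (use Y in auto)
  thus ?thesis
    by blast
qed

lemma bounded_ops_tendsto:
  fixes Y :: "'h :: chilbert_space op"
  assumes lim: "(f \<longlongrightarrow> Y) G" and "G \<noteq> bot" and f: "\<forall>\<^sub>F r in G. f r \<in> bounded_ops"
  shows "Y \<in> bounded_ops"
proof (rule bounded_opsI)
  fix c x
  note app = bounded_linear.tendsto[OF blinfun.bounded_linear_left lim]
  have "((\<lambda>r. c *\<^sub>C blinfun_apply (f r) x) \<longlongrightarrow> c *\<^sub>C blinfun_apply Y x) G"
    by (rule bounded_linear.tendsto[OF bounded_linear_scaleC app])
  moreover have "\<forall>\<^sub>F r in G. c *\<^sub>C blinfun_apply (f r) x = blinfun_apply (f r) (c *\<^sub>C x)"
    using f by eventually_elim (simp add: bounded_ops_scaleC)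
  ultimately have "((\<lambda>r. blinfun_apply (f r) (c *\<^sub>C x)) \<longlongrightarrow> c *\<^sub>C blinfun_apply Y x) G"
    using tendsto_cong by fastforce
  thus "blinfun_apply Y (c *\<^sub>C x) = c *\<^sub>C blinfun_apply Y x"
    using app tendsto_unique[OF \<open>G \<noteq> bot\<close>] by blast
qed

text \<open>
  The forms that test the row norm are continuous under entrywise limits. The entries of the limit
  commute with complex scalars, and therefore have adjoints.
\<close>

lemma row_norm_tendsto_le:
  fixes Y :: "'m :: finite \<Rightarrow> 'h :: chilbert_space op"
  assumes lim: "\<And>j. ((\<lambda>r. f r j) \<longlongrightarrow> Y j) G" and G: "G \<noteq> bot"
    and f: "\<forall>\<^sub>F r in G. (\<forall>j. f r j \<in> bounded_ops) \<and> row_norm (f r) \<le> B" and B: "0 \<le> B"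
  shows "row_norm Y \<le> B"
proof (rule row_norm_leI)
  show "Y j \<in> bounded_ops" for j
    by (rule bounded_ops_tendsto[OF lim G]) (use f in \<open>auto elim: eventually_mono\<close>)
  fix \<xi> :: "'m \<Rightarrow> 'h" and \<eta>
  show "cmod (\<Sum>j\<in>UNIV. cinner (blinfun_apply (Y j) (\<xi> j)) \<eta>)
      \<le> B * L2_set (\<lambda>j. norm (\<xi> j)) UNIV * norm \<eta>"
  proof (rule tendsto_upperbound[OF _ _ G])
    show "((\<lambda>r. cmod (\<Sum>j\<in>UNIV. cinner (blinfun_apply (f r j) (\<xi> j)) \<eta>))
        \<longlongrightarrow> cmod (\<Sum>j\<in>UNIV. cinner (blinfun_apply (Y j) (\<xi> j)) \<eta>)) G"
      by (intro tendsto_norm tendsto_sum bounded_linear.tendsto[OF bounded_linear_cinner_left]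
          bounded_linear.tendsto[OF blinfun.bounded_linear_left] lim)
    show "\<forall>\<^sub>F r in G. cmod (\<Sum>j\<in>UNIV. cinner (blinfun_apply (f r j) (\<xi> j)) \<eta>)
        \<le> B * L2_set (\<lambda>j. norm (\<xi> j)) UNIV * norm \<eta>"
      using f
    proof eventually_elim
      case (elim r)
      have "cmod (\<Sum>j\<in>UNIV. cinner (blinfun_apply (f r j) (\<xi> j)) \<eta>)
          \<le> row_norm (f r) * L2_set (\<lambda>j. norm (\<xi> j)) UNIV * norm \<eta>"
        using elim by (intro cmod_row_form_le) auto
      also have "\<dots> \<le> B * L2_set (\<lambda>j. norm (\<xi> j)) UNIV * norm \<eta>"
        using elim by (intro mult_right_mono) auto
      finally show ?case .
    qed
  qed
qed (rule B)

theorem theorem8p1: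
  fixes F :: "('n :: finite \<Rightarrow> 'h :: chilbert_space op) \<Rightarrow> 'm :: finite \<Rightarrow> 'h op"
  assumes "separable_infinite_dimensional TYPE('h)"
    and "free_holomorphic F"
    and "F ` row_ball \<subseteq> row_cball"
  shows "(\<forall>X\<in>row_ball. row_norm (F X)
            \<le> (row_norm X + row_norm (F (\<lambda>_. 0))) / (1 + row_norm X * row_norm (F (\<lambda>_. 0))))
    \<and> (\<forall>F_bd. (\<forall>j. is_boundary_function (\<lambda>X. F X j) (F_bd j) \<and> F_bd j \<in> nc_disc_algebra) \<longrightarrow>
         (\<forall>X\<in>row_cball. \<exists>Y. is_radial_limit F X Y \<and> row_norm Y
            \<le> (row_norm X + row_norm (F (\<lambda>_. 0))) / (1 + row_norm X * row_norm (F (\<lambda>_. 0)))))"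
proof (intro conjI ballI allI impI)
  show "row_norm (F X)
      \<le> (row_norm X + row_norm (F (\<lambda>_. 0))) / (1 + row_norm X * row_norm (F (\<lambda>_. 0)))"
    if "X \<in> row_ball" for X
    by (rule row_norm_Schwarz_Pick[OF assms(2,3) that])
next
  fix F_bd and X :: "'n \<Rightarrow> 'h op"
  assume bd: "\<forall>j. is_boundary_function (\<lambda>X. F X j) (F_bd j) \<and> F_bd j \<in> nc_disc_algebra"
    and X: "X \<in> row_cball"
  define c where "c = row_norm (F (\<lambda>_. 0))"
  have inf: "\<not> (\<exists>B :: 'h set. finite B \<and> complex_vector.span B = UNIV)"
    using assms(1) by (simp add: separable_infinite_dimensional_def)
  have F_in: "F Z \<in> row_cball" if "Z \<in> row_ball" for Z
    using assms(3) that by blast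
  have rX: "(\<lambda>i. r *\<^sub>R X i) \<in> row_ball" if "0 < r \<and> r < 1" for r
    using that by (intro scaleR_row_ball X) auto
  have "\<exists>Y. ((\<lambda>r. F (\<lambda>i. r *\<^sub>R X i) j) \<longlongrightarrow> Y) (at_left 1)" for j
  proof -
    obtain a where a: "has_free_expansion (\<lambda>X. F X j) a"
        "\<And>\<xi>. ((\<lambda>r. blinfun_apply (free_eval a (\<lambda>i. r *\<^sub>R creation_op i)) \<xi>)
          \<longlongrightarrow> blinfun_apply (F_bd j) \<xi>) (at_left 1)"
      using bd unfolding is_boundary_function_def by blast
    have "norm (F Z j) \<le> 1" if "Z \<in> row_ball" for Z
      using norm_entry_le_row_norm[of "F Z" j] F_in[OF that] by (auto simp: row_cball_def)
    from sum_coefficients_le[OF inf a(1) this]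
    have "cinner (blinfun_apply (F_bd j) (ket [])) (ket \<alpha>) = a \<alpha>" for \<alpha>
      using a(2) by (intro boundary_function_coefficient)
    moreover have "F_bd j \<in> closure (complex_vector.span (range (word_op creation_op)))"
      using bd nc_disc_algebra_subset_closure by blast
    ultimately obtain Y where Y: "((\<lambda>r. free_eval a (\<lambda>i. r *\<^sub>R X i)) \<longlongrightarrow> Y) (at_left 1)"
      using radial_limit_exists[OF X] by blast
    have "\<forall>\<^sub>F r in at_left 1. free_eval a (\<lambda>i. r *\<^sub>R X i) = F (\<lambda>i. r *\<^sub>R X i) j"
      using eventually_at_left_1
      by eventually_elim (use free_expansion_free_eval[OF a(1) rX] in simp)
    with Y show ?thesis
      using tendsto_cong by fastforce
  qed
  then obtain Y where Y: "\<And>j. ((\<lambda>r. F (\<lambda>i. r *\<^sub>R X i) j) \<longlongrightarrow> Y j) (at_left 1)"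
    by metis
  have \<rho>: "0 \<le> row_norm X" "row_norm X \<le> 1" and Xb: "\<And>i. X i \<in> bounded_ops"
    using X by (auto simp: row_cball_def row_norm_nonneg)
  have "(\<lambda>_ :: 'n. 0 :: 'h op) \<in> row_ball"
    by (auto simp: row_ball_def row_norm_zero bounded_ops_def)
  hence c: "0 \<le> c" "c \<le> 1"
    using F_in by (auto simp: c_def row_norm_nonneg row_cball_def)
  have "row_norm Y \<le> (row_norm X + c) / (1 + row_norm X * c)"
  proof (rule row_norm_tendsto_le[OF Y])
    show "\<forall>\<^sub>F r in at_left 1. (\<forall>j. F (\<lambda>i. r *\<^sub>R X i) j \<in> bounded_ops)
        \<and> row_norm (F (\<lambda>i. r *\<^sub>R X i)) \<le> (row_norm X + c) / (1 + row_norm X * c)"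
      using eventually_at_left_1
    proof eventually_elim
      case (elim r)
      let ?s = "row_norm (\<lambda>i. r *\<^sub>R X i)"
      have "?s \<le> \<bar>r\<bar> * row_norm X"
        by (rule row_norm_scaleR_le[OF Xb])
      also have "\<dots> \<le> 1 * row_norm X"
        using elim \<rho> by (intro mult_right_mono) auto
      finally have "(?s + c) / (1 + ?s * c) \<le> (row_norm X + c) / (1 + row_norm X * c)"
        using \<rho> c by (intro Schwarz_Pick_fraction_mono) (auto simp: row_norm_nonneg)
      moreover have "row_norm (F (\<lambda>i. r *\<^sub>R X i)) \<le> (?s + c) / (1 + ?s * c)"
        unfolding c_def by (rule row_norm_Schwarz_Pick[OF assms(2,3) rX[OF elim]])
      ultimately show ?case
        using F_in[OF rX[OF elim]] by (auto simp: row_cball_def)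
    qed
    show "0 \<le> (row_norm X + c) / (1 + row_norm X * c)"
      using \<rho> c by (intro divide_nonneg_nonneg) auto
  qed simp
  with Y show "\<exists>Y. is_radial_limit F X Y \<and> row_norm Y
      \<le> (row_norm X + row_norm (F (\<lambda>_. 0))) / (1 + row_norm X * row_norm (F (\<lambda>_. 0)))"
    unfolding is_radial_limit_def c_def by blast
qed

end
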